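(* For every $(\mu|\lambda)\in\Sigma$, $$s_{(\mu|\lambda)}=\lim_{n}\mathcal{K}_{\mu*0^{n}*\mathrm{rev}(\lambda)} .$$
   Context: **Combinatorics.** A composition is a finite tuple $\mu=(\mu_1,\ldots,\mu_n)$ of non-negative integers (the empty one $\emptyset$ is allowed); $\ell(\mu)=n$. It is reduced if $\mu=\emptyset$ or $\mu_{\ell(\mu)}\neq 0$. A partition is a composition with $\lambda_1\ge\dots\ge\lambda_n\ge1$ ($\emptyset$ allowed). $\Sigma$ is the set of pairs $(\mu|\lambda)$ with $\mu$ a reduced composition and $\lambda$ a partition. $*$ denotes concatenation; $0^n$ is the tuple of $n$ zeros; $\mathrm{rev}(\lambda)$ is $\lambda$ with its entries in reversed order. **Almost symmetric functions.** $\mathscr{P}_n^+=\mathbb{Q}(q,t)[x_1,\ldots,x_n]$; $\mathscr{P}(k)^+=\mathbb{Q}(q,t)[x_1,\ldots,x_k]\otimes\Lambda[\mathfrak{X}_k]$, where $\Lambda[\mathfrak{X}_k]$ is the ring of symmetric functions in $x_{k+1},x_{k+2},\ldots$; $\mathscr{P}_{as}^+=\bigcup_{k\ge0}\mathscr{P}(k)^+$. With $X=x_1+x_2+\cdots$, $\{x^\mu m_\lambda[X]:(\mu|\lambda)\in\Sigma\}$ is a basis of $\mathscr{P}_{as}^+$ ($m_\lambda$ = monomial symmetric functions). **Limits (in the sense of Ion–Wu).** A sequence $f_n\in\mathscr{P}_n^+$ (defined for large $n$) converges to $f\in\mathscr{P}_{as}^+$ if there are finitely many $(\alpha^{(i)}|\nu^{(i)})\in\Sigma$,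 $1\le i\le N$, and scalars $c_n^{(i)},c^{(i)}\in\mathbb{Q}(q,t)$ such that for all large $n$, $f_n=\sum_i c_n^{(i)}x^{\alpha^{(i)}}m_{\nu^{(i)}}[x_1+\cdots+x_n]$, with $c_n^{(i)}\to c^{(i)}$ $t$-adically, and $f=\sum_i c^{(i)}x^{\alpha^{(i)}}m_{\nu^{(i)}}[X]$. In the claim, $\mathcal{K}_{\mu*0^n*\mathrm{rev}(\lambda)}$ is a polynomial in $x_1,\ldots,x_{\ell(\mu)+n+\ell(\lambda)}$, i.e. is the term of index $\ell(\mu)+n+\ell(\lambda)$ of such a sequence. **Key polynomials.** $\xi_i(f)=\frac{x_if-x_{i+1}s_i(f)}{x_i-x_{i+1}}$, where $s_i$ swaps $x_i,x_{i+1}$. The key polynomials $\mathcal{K}_\alpha(x_1,\ldots,x_n)$, $\alpha\in\mathbb{Z}_{\ge0}^n$, are determined by: $\mathcal{K}_\alpha=x^\alpha$ if $\alpha_1\ge\dots\ge\alpha_n$; and $\mathcal{K}_{s_i(\alpha)}=\xi_i(\mathcal{K}_\alpha)$ if $\alpha_i>\alpha_{i+1}$ ($s_i(\alpha)$ swaps entries $i,i+1$). One has $\mathcal{K}_{\alpha*0}=\mathcal{K}_\alpha$. **Almost symmetric Schur functions.** Let $\mathfrak{S}_{(1^k,n-k)}\subset\mathfrak{S}_n$ be the permutations fixing $1,\ldots,k$. For $0\le k\le n$, $$W_k^{(n)}(f)=\sum_{\sigma\in\mathfrak{S}_{(1^k,n-k)}}\sigma\Big(f\prod_{k+1\le i<j\le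 n}\frac1{1-x_j/x_i}\Big),\qquad f\in\mathscr{P}_n^+,$$ with $\sigma$ permuting variables. These operators are compatible with setting $x_{n+1}=0$, and $W_k=\lim_nW_k^{(n)}$ is the operator on $\mathscr{P}_{as}^+$ such that $W_k(f)(x_1,\ldots,x_n,0,0,\ldots)=W_k^{(n)}(f(x_1,\ldots,x_n,0,0,\ldots))$ for all $n\ge k$. The functions $s_{(\mu|\lambda)}$, $(\mu|\lambda)\in\Sigma$, are defined recursively by $s_{(\mu|\emptyset)}=\mathcal{K}_\mu$, and, if $\mu_r\ge\lambda_1$ (and $(\mu_1,\ldots,\mu_{r-1})$ is reduced), $s_{(\mu_1,\ldots,\mu_{r-1}|\mu_r,\lambda_1,\ldots,\lambda_\ell)}=W_{r-1}\big(s_{(\mu_1,\ldots,\mu_r|\lambda_1,\ldots,\lambda_\ell)}\big)$. *)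

theory Defs
  imports
    "HOL-Library.Poly_Mapping"
    "HOL-Computational_Algebra.Polynomial_Factorial"
    "HOL-Combinatorics.Permutations"
begin

section \<open>Compositions and partitions\<close>

definition reduced :: "nat list \<Rightarrow> bool" where
  "reduced \<mu> \<longleftrightarrow> \<mu> = [] \<or> last \<mu> \<noteq> 0"

definition is_partition :: "nat list \<Rightarrow> bool" where
  "is_partition \<nu> \<longleftrightarrow> sorted_wrt (\<ge>) \<nu> \<and> (\<forall>a\<in>set \<nu>. 1 \<le> a)"

definition Sig :: "(nat list \<times> nat list) set" where
  "Sig = {(\<mu>, \<nu>). reduced \<mu> \<and> is_partition \<nu>}"


section \<open>The ground field\<close>

text \<open>\<open>\<rat>(q,t)\<close>, built as \<open>\<rat>(q)(t)\<close>: the inner polynomial variable is \<open>q\<close>, the outer one \<open>t\<close>.\<close>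

type_synonym qt = "rat poly fract poly fract"

definition t_par :: qt where
  "t_par = to_fract [:0, 1:]"

text \<open>\<open>v\<^sub>t (c n - l) \<rightarrow> \<infinity>\<close>, where having \<open>t\<close>-adic valuation at least \<open>k\<close> means
  lying in \<open>t\<^sup>k\<close> times the local ring of rational functions without pole at \<open>t = 0\<close>.\<close>

definition t_adic_tendsto :: "(nat \<Rightarrow> qt) \<Rightarrow> qt \<Rightarrow> bool" where
  "t_adic_tendsto c l \<longleftrightarrow>
     (\<forall>k. \<exists>n0. \<forall>n\<ge>n0. \<exists>a b. poly b 0 \<noteq> 0 \<and> c n - l = t_par ^ k * Fract a b)"


section \<open>Polynomials and formal series\<close>

text \<open>Variables are numbered from 0: the variable \<open>x\<^sub>i\<close> of the literature has index \<open>i - 1\<close>.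
  A monomial is its finitely supported exponent vector. All rings \<open>\<rat>(q,t)[x\<^sub>1, \<dots>, x\<^sub>n]\<close> are
  regarded as subrings of the polynomial ring \<open>mpol\<close> in countably many variables;
  \<open>ser\<close> is the space of formal series, given by their coefficient functions,
  and contains \<open>mpol\<close> via \<open>Poly_Mapping.lookup\<close>.\<close>

type_synonym mon = "nat \<Rightarrow>\<^sub>0 nat"
type_synonym mpol = "mon \<Rightarrow>\<^sub>0 qt"
type_synonym ser = "mon \<Rightarrow> qt"

definition Var :: "nat \<Rightarrow> mpol" where
  "Var i = Poly_Mapping.single (Poly_Mapping.single i 1) 1"

definition Const :: "qt \<Rightarrow> mpol" where
  "Const c = Poly_Mapping.single 0 c"

definition xpow :: "nat list \<Rightarrow> mpol" where
  "xpow \<alpha> = (\<Prod>i<length \<alpha>. Var i ^ (\<alpha> ! i))"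

text \<open>The action of a permutation by \<open>Var i \<mapsto> Var (\<sigma> i)\<close>: the coefficient of
  \<open>\<Prod>i. Var i ^ e i\<close> in \<open>perm_pol \<sigma> f\<close> is that of \<open>\<Prod>i. Var i ^ e (\<sigma> i)\<close> in \<open>f\<close>.\<close>

definition perm_pol :: "(nat \<Rightarrow> nat) \<Rightarrow> mpol \<Rightarrow> mpol" where
  "perm_pol \<sigma> f = Poly_Mapping.map_key (Poly_Mapping.map_key \<sigma>) f"

lemma perm_pol_Var:
  assumes "bij \<sigma>"
  shows "perm_pol \<sigma> (Var i) = Var (\<sigma> i)"
proof -
  have inj: "inj \<sigma>" using assms by (rule bij_is_inj)
  have inj2: "inj (Poly_Mapping.map_key \<sigma> :: mon \<Rightarrow> mon)"
  proof (rule injI)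
    fix a b :: mon
    assume eq: "Poly_Mapping.map_key \<sigma> a = Poly_Mapping.map_key \<sigma> b"
    have "Poly_Mapping.lookup a (\<sigma> j) = Poly_Mapping.lookup b (\<sigma> j)" for j
      using arg_cong[OF eq, of "\<lambda>p. Poly_Mapping.lookup p j"] inj
      by (simp add: map_key.rep_eq)
    then show "a = b"
      using assms by (metis bij_pointE poly_mapping_eqI)
  qed
  have "Poly_Mapping.map_key \<sigma> (Poly_Mapping.single (\<sigma> i) (1 :: nat)) = Poly_Mapping.single i 1"
    using inj by (rule map_key_single)
  then show ?thesis
    using map_key_single[OF inj2, of "Poly_Mapping.single (\<sigma> i) 1" "1 :: qt"]
    by (simp add: perm_pol_def Var_def)
qed

text \<open>\<open>f(x\<^sub>1, \<dots>, x\<^sub>n, 0, 0, \<dots>)\<close>. This is a polynomial for every \<open>f\<close> in \<open>P_as\<close> below;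
  the value for other series is irrelevant.\<close>

definition trunc :: "nat \<Rightarrow> ser \<Rightarrow> mpol" where
  "trunc n f = Abs_poly_mapping (\<lambda>m. f m when Poly_Mapping.keys m \<subseteq> {..<n})"

text \<open>Product of a series with the monomial of exponent \<open>a\<close>
  (the sum has at most one term).\<close>

definition mon_times :: "mon \<Rightarrow> ser \<Rightarrow> ser" where
  "mon_times a f = (\<lambda>m. \<Sum>m' | a + m' = m. f m')"

text \<open>\<open>m\<^sub>\<nu>[X]\<close>: the sum of all distinct monomials whose nonzero exponents are, up to order,
  the parts of \<open>\<nu>\<close>. Then \<open>trunc n (msym \<nu>)\<close> is \<open>m\<^sub>\<nu>[x\<^sub>1 + \<dots> + x\<^sub>n]\<close>.\<close>

definition msym :: "nat list \<Rightarrow> ser" where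
  "msym \<nu> = (\<lambda>m. if image_mset (Poly_Mapping.lookup m) (mset_set (Poly_Mapping.keys m)) = mset \<nu>
                 then 1 else 0)"


section \<open>Almost symmetric functions\<close>

text \<open>\<open>\<Lambda>[\<XX>\<^sub>k]\<close>: series of bounded degree in the variables of index at least \<open>k\<close>, that is
  \<open>x\<^bsub>k+1\<^esub>, x\<^bsub>k+2\<^esub>, \<dots>\<close>, invariant under permutations of these.\<close>

definition Lam :: "nat \<Rightarrow> ser set" where
  "Lam k = {g.
     (\<exists>d. \<forall>m. g m \<noteq> 0 \<longrightarrow> (\<Sum>i\<in>Poly_Mapping.keys m. Poly_Mapping.lookup m i) \<le> d) \<and>
     (\<forall>m. g m \<noteq> 0 \<longrightarrow> Poly_Mapping.keys m \<subseteq> {k..}) \<and>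
     (\<forall>n \<sigma> m. \<sigma> permutes {k..<n} \<longrightarrow> g (Poly_Mapping.map_key \<sigma> m) = g m)}"

text \<open>\<open>\<rat>(q,t)[x\<^sub>1, \<dots>, x\<^sub>k] \<otimes> \<Lambda>[\<XX>\<^sub>k]\<close>: finite sums of products of a monomial in the first \<open>k\<close>
  variables and a symmetric function in the others.\<close>

definition P_part :: "nat \<Rightarrow> ser set" where
  "P_part k = {f. \<exists>A g. finite A \<and>
     (\<forall>a\<in>A. Poly_Mapping.keys a \<subseteq> {..<k} \<and> g a \<in> Lam k) \<and>
     f = (\<lambda>m. \<Sum>a\<in>A. mon_times a (g a) m)}"

definition P_as :: "ser set" where
  "P_as = (\<Union>k. P_part k)"

definition as_tendsto :: "(nat \<Rightarrow> mpol) \<Rightarrow> ser \<Rightarrow> bool" where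
  "as_tendsto F f \<longleftrightarrow>
     (\<exists>(N::nat) (\<alpha> :: nat \<Rightarrow> nat list) (\<nu> :: nat \<Rightarrow> nat list) (c :: nat \<Rightarrow> nat \<Rightarrow> qt) (l :: nat \<Rightarrow> qt).
        (\<forall>i<N. (\<alpha> i, \<nu> i) \<in> Sig) \<and>
        (\<exists>n0. \<forall>n\<ge>n0. F n = (\<Sum>i<N. Const (c i n) * xpow (\<alpha> i) * trunc n (msym (\<nu> i)))) \<and>
        (\<forall>i<N. t_adic_tendsto (c i) (l i)) \<and>
        f = (\<lambda>m. \<Sum>i<N. l i * mon_times (Poly_Mapping.nth (\<alpha> i)) (msym (\<nu> i)) m))"


section \<open>Key polynomials\<close>

text \<open>A rational function that is a polynomial, viewed as a polynomial.\<close>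

definition pol_of_fract :: "mpol fract \<Rightarrow> mpol" where
  "pol_of_fract r = (THE p. to_fract p = r)"

definition xi :: "nat \<Rightarrow> mpol \<Rightarrow> mpol" where
  "xi i f = pol_of_fract
     (to_fract (Var i * f - Var (Suc i) * perm_pol (Transposition.transpose i (Suc i)) f) /
      to_fract (Var i - Var (Suc i)))"

definition swap_at :: "nat \<Rightarrow> nat list \<Rightarrow> nat list" where
  "swap_at i \<alpha> = \<alpha>[i := \<alpha> ! Suc i, Suc i := \<alpha> ! i]"

text \<open>The family of key polynomials is the unique one satisfying these two rules.\<close>

definition key_family :: "(nat list \<Rightarrow> mpol) \<Rightarrow> bool" where
  "key_family K \<longleftrightarrow>
     (\<forall>\<alpha>. sorted_wrt (\<ge>) \<alpha> \<longrightarrow> K \<alpha> = xpow \<alpha>) \<and>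
     (\<forall>\<alpha> i. Suc i < length \<alpha> \<and> \<alpha> ! i > \<alpha> ! Suc i \<longrightarrow> K (swap_at i \<alpha>) = xi i (K \<alpha>))"

definition key_poly :: "nat list \<Rightarrow> mpol" where
  "key_poly = (THE K. key_family K)"


section \<open>Almost symmetric Schur functions\<close>

text \<open>In the summand, \<open>\<sigma>\<close> has been applied to each factor of
  \<open>f * \<Prod>\<^bsub>i<j\<^esub> 1 / (1 - x\<^sub>j / x\<^sub>i)\<close>.\<close>

definition W_fin :: "nat \<Rightarrow> nat \<Rightarrow> mpol \<Rightarrow> mpol" where
  "W_fin k n f = pol_of_fract
     (\<Sum>\<sigma> | \<sigma> permutes {k..<n}.
        to_fract (perm_pol \<sigma> f) *
        (\<Prod>(i, j)\<in>{(i, j). k \<le> i \<and> i < j \<and> j < n}.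
           1 / (1 - to_fract (Var (\<sigma> j)) / to_fract (Var (\<sigma> i)))))"

definition W :: "nat \<Rightarrow> ser \<Rightarrow> ser" where
  "W k f = (THE g. g \<in> P_as \<and> (\<forall>n\<ge>k. trunc n g = W_fin k n (trunc n f)))"

text \<open>The recursion moves the first part of \<open>\<nu>\<close> to the end of \<open>\<mu>\<close>. For \<open>(\<mu>, a # \<nu>) \<in> Sig\<close> we have
  \<open>(\<mu> @ [a], \<nu>) \<in> Sig\<close>, and the side conditions of the recursion (\<open>\<mu>\<close> reduced, \<open>a\<close> at least
  the first part of \<open>\<nu>\<close>) hold; outside \<open>Sig\<close> the values are irrelevant.\<close>

fun as_schur :: "nat list \<Rightarrow> nat list \<Rightarrow> ser" where
  "as_schur \<mu> [] = Poly_Mapping.lookup (key_poly \<mu>)"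
| "as_schur \<mu> (a # \<nu>) = W (length \<mu>) (as_schur (\<mu> @ [a]) \<nu>)"

end

theory Submission
  imports Defs
begin

text \<open>
  For every \<open>N \<ge> \<ell>(\<mu>) + \<ell>(\<nu>)\<close> the key polynomial of \<open>\<mu> * 0\<^sup>n * rev \<nu>\<close> in \<open>N\<close> variables is equal to
  the truncation \<open>s_(\<mu>|\<nu>)(x\<^sub>1, \<dots>, x\<^sub>N, 0, \<dots>)\<close> (lemma \<open>as_schur_truncations\<close>). The sequence is thus
  the sequence of truncations of one series, and it converges with constant coefficients as soon
  as that series is a finite combination of products \<open>x\<^sup>\<alpha> m\<^sub>\<nu>[X]\<close>; every almost symmetric series
  is one (\<open>spanned_almost_symmetric\<close>).

  The equality of truncations is proved by induction on \<open>\<nu>\<close>. The recursion applies \<open>W\<^sub>k\<close>, which in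
  \<open>n\<close> variables is the Demazure operator of the longest permutation of the variables after the
  \<open>k\<close>-th one. Write it as \<open>f \<mapsto> Alt(x\<^sup>\<rho> f) / \<Delta>\<close>, the quotient of an antisymmetrisation by a
  Vandermonde product. It does not change if some \<open>\<xi>\<^sub>i\<close> acting on the variables after the \<open>k\<close>-th one
  is applied first (\<open>Alt_rho_xi\<close>), and it fixes the polynomials that are symmetric in these
  variables (\<open>W_rel_symmetric\<close>). Let \<open>a\<close> be at least every part of \<open>\<nu>\<close>. Moving \<open>a\<close> to the right through
  \<open>0\<^sup>m * rev \<nu>\<close> changes the key polynomial by operators \<open>\<xi>\<^sub>i\<close> only, so \<open>K\<close> of \<open>\<mu> * a * 0\<^sup>m * rev \<nu>\<close> and of
  \<open>\<mu> * 0\<^sup>m * rev \<nu> * a\<close> have the same image. The entries of the second composition increase weakly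
  after \<open>\<mu>\<close>, hence its key polynomial is symmetric in the corresponding variables
  (\<open>ps_key_poly\<close>) and is itself the image.

  Three objects are given by descriptions, and these have to be shown to determine them. The
  key polynomials exist because the \<open>\<xi>\<^sub>i\<close> satisfy the braid relations (\<open>xi_braid\<close>, \<open>key_ascent\<close>). The
  fraction in the finite symmetriser is a polynomial, because the key polynomial just described
  solves the equation without denominators (\<open>W_fin_eqI\<close>). Finally \<open>W\<^sub>k\<close> of an almost symmetric
  Schur function exists because that equation is compatible with setting the last variable to
  zero (\<open>W_rel_tr\<close>), so that its solutions for all \<open>n\<close> are the truncations of one series.
\<close>

abbreviation look :: "('a \<Rightarrow>\<^sub>0 'b::zero) \<Rightarrow> 'a \<Rightarrow> 'b" where
  "look \<equiv> Poly_Mapping.lookup"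

text \<open>The variable of index \<open>i\<close> has in \<open>act \<sigma> m\<close> the exponent that the variable of index \<open>\<sigma> i\<close> has in \<open>m\<close>.
  So \<open>act\<close> reverses the order of composition, and the coefficient of \<open>perm_pol \<sigma> f\<close> at \<open>m\<close> is that of \<open>f\<close> at \<open>act \<sigma> m\<close>.\<close>

abbreviation act :: "(nat \<Rightarrow> nat) \<Rightarrow> mon \<Rightarrow> mon" where
  "act \<equiv> Poly_Mapping.map_key"

section \<open>Monomials\<close>

definition mdeg :: "mon \<Rightarrow> nat" where
  "mdeg m = (\<Sum>i\<in>Poly_Mapping.keys m. look m i)"

lemma mdeg_superset:
  assumes "finite S" "Poly_Mapping.keys m \<subseteq> S"
  shows "mdeg m = (\<Sum>i\<in>S. look m i)"
  unfolding mdeg_def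
  by (rule sum.mono_neutral_left) (use assms in \<open>auto simp: in_keys_iff\<close>)

lemma keys_add_mon: "Poly_Mapping.keys (a + b :: mon) = Poly_Mapping.keys a \<union> Poly_Mapping.keys b"
  by (auto simp: in_keys_iff lookup_add)

lemma mdeg_add: "mdeg (a + b) = mdeg a + mdeg b"
proof -
  let ?S = "Poly_Mapping.keys a \<union> Poly_Mapping.keys b"
  have "mdeg (a + b) = (\<Sum>i\<in>?S. look (a + b) i)"
    by (rule mdeg_superset) (auto simp: keys_add_mon)
  also have "\<dots> = (\<Sum>i\<in>?S. look a i) + (\<Sum>i\<in>?S. look b i)"
    by (simp add: lookup_add sum.distrib)
  also have "\<dots> = mdeg a + mdeg b"
    by (simp add: mdeg_superset[of ?S])
  finally show ?thesis .
qed

lemma mdeg_single [simp]: "mdeg (Poly_Mapping.single i e) = e"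
  by (simp add: mdeg_def)

lemma mdeg_zero [simp]: "mdeg 0 = 0"
  by (simp add: mdeg_def)

lemma lookup_le_mdeg: "look m i \<le> mdeg m"
proof (cases "i \<in> Poly_Mapping.keys m")
  case True
  then show ?thesis unfolding mdeg_def by (intro member_le_sum) auto
qed (simp add: in_keys_iff)

lemma look_act [simp]: "bij \<sigma> \<Longrightarrow> look (act \<sigma> m) i = look m (\<sigma> i)"
  by (simp add: map_key.rep_eq bij_is_inj)

lemma keys_act: "bij \<sigma> \<Longrightarrow> Poly_Mapping.keys (act \<sigma> m) = \<sigma> -` Poly_Mapping.keys m"
  by (auto simp: in_keys_iff)

lemma act_add: "bij \<sigma> \<Longrightarrow> act \<sigma> (a + b) = act \<sigma> a + act \<sigma> b"
  by (rule poly_mapping_eqI) (simp add: lookup_add)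

lemma act_act: "bij \<sigma> \<Longrightarrow> bij \<tau> \<Longrightarrow> act \<sigma> (act \<tau> m) = act (\<tau> \<circ> \<sigma>) m"
  by (rule poly_mapping_eqI) (simp add: bij_comp)

lemma act_id [simp]: "act id m = m" "act (\<lambda>x. x) m = m"
  by (auto intro!: poly_mapping_eqI simp: map_key.rep_eq)

lemma act_inv: "bij \<sigma> \<Longrightarrow> act \<sigma> (act (inv \<sigma>) m) = m" "bij \<sigma> \<Longrightarrow> act (inv \<sigma>) (act \<sigma> m) = m"
  by (auto intro!: poly_mapping_eqI simp: bij_imp_bij_inv bij_is_inj bij_is_surj surj_f_inv_f)

lemma act_inject: "bij \<sigma> \<Longrightarrow> act \<sigma> a = act \<sigma> b \<longleftrightarrow> a = b"
  by (metis act_inv(2))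

lemma inj_act: "bij \<sigma> \<Longrightarrow> inj (act \<sigma>)"
  by (simp add: act_inject inj_def)

lemma mdeg_act: assumes "bij \<sigma>" shows "mdeg (act \<sigma> m) = mdeg m"
proof -
  have "mdeg m = (\<Sum>i\<in>\<sigma> ` Poly_Mapping.keys (act \<sigma> m). look m i)"
    using assms by (intro mdeg_superset) (auto simp: keys_act surj_image_vimage_eq bij_is_surj)
  also have "\<dots> = mdeg (act \<sigma> m)"
    unfolding mdeg_def using assms
    by (subst sum.reindex) (auto intro: inj_on_subset bij_is_inj)
  finally show ?thesis by simp
qed

section \<open>Polynomials\<close>

lemma additive_eqI:
  fixes \<phi> \<psi> :: "mpol \<Rightarrow> 'b::comm_monoid_add"
  assumes "\<phi> 0 = \<psi> 0"
    and "\<And>f g. \<phi> (f + g) = \<phi> f + \<phi> g" "\<And>f g. \<psi> (f + g) = \<psi> f + \<psi> g"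
    and "\<And>m c. \<phi> (Poly_Mapping.single m c) = \<psi> (Poly_Mapping.single m c)"
  shows "\<phi> f = \<psi> f"
proof (induction f rule: update_induct)
  case (update f a b)
  have "Poly_Mapping.update a b f = f + Poly_Mapping.single a b"
    using update(1) by (intro poly_mapping_eqI)
      (auto simp: lookup_update lookup_add lookup_single in_keys_iff when_def)
  then show ?case using update assms by simp
qed (use assms in simp)

text \<open>Products of single terms are explicit, and this reduction to them is how permuting variables
  and setting variables to zero are recognised as ring homomorphisms.\<close>

lemma additive_mult_eqI:
  fixes \<phi> :: "mpol \<Rightarrow> mpol"
  assumes z: "\<phi> 0 = 0" and add: "\<And>f g. \<phi> (f + g) = \<phi> f + \<phi> g"
    and s: "\<And>a c b d. \<phi> (Poly_Mapping.single a c * Poly_Mapping.single b d) =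
       \<phi> (Poly_Mapping.single a c) * \<phi> (Poly_Mapping.single b d)"
  shows "\<phi> (f * g) = \<phi> f * \<phi> g"
proof (rule additive_eqI[of "\<lambda>f. \<phi> (f * g)" "\<lambda>f. \<phi> f * \<phi> g"])
  fix m c
  show "\<phi> (Poly_Mapping.single m c * g) = \<phi> (Poly_Mapping.single m c) * \<phi> g"
    by (rule additive_eqI[of "\<lambda>g. \<phi> (Poly_Mapping.single m c * g)"])
      (auto simp: z add s algebra_simps)
qed (auto simp: z add algebra_simps)

lemma Var_power: "Var i ^ e = Poly_Mapping.single (Poly_Mapping.single i e) 1"
proof (induction e)
  case (Suc e)
  then show ?case by (simp add: Var_def mult_single flip: single_add)
qed simp

lemma Const_mult_single: "Const c * Poly_Mapping.single m d = Poly_Mapping.single m (c * d)"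
  by (simp add: Const_def mult_single)

lemma mpol_generated [case_names Const Var add mult]:
  assumes C: "\<And>c. P (Const c)" and V: "\<And>i. P (Var i)"
    and A: "\<And>f g. P f \<Longrightarrow> P g \<Longrightarrow> P (f + g)" and M: "\<And>f g. P f \<Longrightarrow> P g \<Longrightarrow> P (f * g)"
  shows "P f"
proof -
  have mon: "P (Poly_Mapping.single m 1)" for m :: mon
  proof (induction m rule: update_induct)
    case const
    show ?case using C[of 1] by (simp add: Const_def)
  next
    case (update m i e)
    have "Poly_Mapping.update i e m = m + Poly_Mapping.single i e"
      using update(1) by (intro poly_mapping_eqI)
        (auto simp: lookup_update lookup_add lookup_single in_keys_iff when_def)
    then have eq: "Poly_Mapping.single (Poly_Mapping.update i e m) (1 :: qt)
        = Poly_Mapping.single m 1 * Var i ^ e"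
      by (simp add: Var_power mult_single)
    have "P (Var i ^ e)"
    proof (induction e)
      case 0
      show ?case using C[of 1] by (simp add: Const_def)
    qed (use M V in simp)
    then show ?case unfolding eq by (rule M[OF update(3)])
  qed
  show ?thesis
  proof (induction f rule: update_induct)
    case const
    show ?case using C[of 0] by (simp add: Const_def)
  next
    case (update f a b)
    have "Poly_Mapping.update a b f = f + Const b * Poly_Mapping.single a 1"
      using update(1) by (intro poly_mapping_eqI)
        (auto simp: lookup_update lookup_add lookup_single in_keys_iff when_def Const_mult_single)
    then show ?case using update A M C mon by simp
  qed
qed

lemma Var_neq_0 [simp]: "Var i \<noteq> 0"
  by (metis Var_def lookup_single_eq lookup_zero zero_neq_one)

lemma Var_inject [simp]: "Var i = Var j \<longleftrightarrow> i = j"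
proof
  assume "Var i = Var j"
  then have "look (Var i) (Poly_Mapping.single i 1) = look (Var j) (Poly_Mapping.single i 1)"
    by simp
  then have "look (Poly_Mapping.single j (1::nat)) i = look (Poly_Mapping.single i 1) i"
    by (auto simp: Var_def lookup_single[of "Poly_Mapping.single _ _"] when_def split: if_splits)
  then show "i = j"
    by (simp add: lookup_single when_def split: if_splits)
qed simp

subsection \<open>Permutations of variables\<close>

lemma look_perm_pol [simp]: "bij \<sigma> \<Longrightarrow> look (perm_pol \<sigma> f) m = look f (act \<sigma> m)"
  by (simp add: perm_pol_def map_key.rep_eq inj_act)

lemma perm_pol_zero [simp]: "bij \<sigma> \<Longrightarrow> perm_pol \<sigma> 0 = 0"
  by (rule poly_mapping_eqI) simp

lemma perm_pol_add: "bij \<sigma> \<Longrightarrow> perm_pol \<sigma> (f + g) = perm_pol \<sigma> f + perm_pol \<sigma> g"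
  by (rule poly_mapping_eqI) (simp add: lookup_add)

lemma perm_pol_diff: "bij \<sigma> \<Longrightarrow> perm_pol \<sigma> (f - g) = perm_pol \<sigma> f - perm_pol \<sigma> g"
  by (rule poly_mapping_eqI) (simp add: lookup_minus)

lemma perm_pol_single:
  assumes "bij \<sigma>"
  shows "perm_pol \<sigma> (Poly_Mapping.single m c) = Poly_Mapping.single (act (inv \<sigma>) m) c"
proof (rule poly_mapping_eqI)
  fix k
  have "m = act \<sigma> k \<longleftrightarrow> act (inv \<sigma>) m = k"
    using act_inv[OF assms] by metis
  then show "look (perm_pol \<sigma> (Poly_Mapping.single m c)) k
      = look (Poly_Mapping.single (act (inv \<sigma>) m) c) k"
    using assms by (simp add: lookup_single when_def)
qed

lemma perm_pol_mult:
  assumes "bij \<sigma>"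
  shows "perm_pol \<sigma> (f * g) = perm_pol \<sigma> f * perm_pol \<sigma> g"
  by (rule additive_mult_eqI)
    (use assms in \<open>auto simp: perm_pol_add perm_pol_single mult_single act_add bij_imp_bij_inv\<close>)

lemma perm_pol_Const [simp]: "bij \<sigma> \<Longrightarrow> perm_pol \<sigma> (Const c) = Const c"
  by (simp add: Const_def perm_pol_single bij_imp_bij_inv bij_is_inj)

lemma perm_pol_one [simp]: "bij \<sigma> \<Longrightarrow> perm_pol \<sigma> 1 = 1"
  using perm_pol_Const[of \<sigma> 1] by (simp add: Const_def)

lemma perm_pol_prod: "bij \<sigma> \<Longrightarrow> perm_pol \<sigma> (\<Prod>i\<in>S. f i) = (\<Prod>i\<in>S. perm_pol \<sigma> (f i))"
  by (induction S rule: infinite_finite_induct) (auto simp: perm_pol_mult)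

lemma perm_pol_comp:
  "bij \<sigma> \<Longrightarrow> bij \<tau> \<Longrightarrow> perm_pol \<sigma> (perm_pol \<tau> f) = perm_pol (\<sigma> \<circ> \<tau>) f"
  by (rule poly_mapping_eqI) (simp add: act_act bij_comp)

lemma perm_pol_id [simp]: "perm_pol id f = f"
  by (rule poly_mapping_eqI) simp

subsection \<open>Setting variables to zero\<close>

definition tr :: "nat \<Rightarrow> mpol \<Rightarrow> mpol" where
  "tr n f = trunc n (look f)"

lemma look_tr [simp]: "look (tr n f) m = (look f m when Poly_Mapping.keys m \<subseteq> {..<n})"
proof -
  have "finite {m. (look f m when Poly_Mapping.keys m \<subseteq> {..<n}) \<noteq> 0}"
    by (rule finite_subset[OF _ finite_lookup[of f]]) auto
  then show ?thesis by (simp add: tr_def trunc_def)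
qed

lemma tr_zero [simp]: "tr n 0 = 0"
  by (rule poly_mapping_eqI) simp

lemma tr_add: "tr n (f + g) = tr n f + tr n g"
  by (rule poly_mapping_eqI) (simp add: lookup_add when_add_distrib)

lemma tr_diff: "tr n (f - g) = tr n f - tr n g"
  by (rule poly_mapping_eqI) (simp add: lookup_minus when_diff_distrib)

lemma tr_single:
  "tr n (Poly_Mapping.single m c) = (Poly_Mapping.single m c when Poly_Mapping.keys m \<subseteq> {..<n})"
  by (rule poly_mapping_eqI) (auto simp: lookup_single when_def)

lemma tr_mult: "tr n (f * g) = tr n f * tr n g"
  by (rule additive_mult_eqI) (auto simp: tr_add tr_single mult_single keys_add_mon when_def)

lemma tr_Const [simp]: "tr n (Const c) = Const c"
  by (simp add: Const_def tr_single)

lemma tr_one [simp]: "tr n 1 = 1"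
  using tr_Const[of n 1] by (simp add: Const_def)

lemma tr_Var: "tr n (Var i) = (if i < n then Var i else 0)"
  by (simp add: Var_def tr_single when_def)

lemma tr_prod: "tr n (\<Prod>i\<in>S. f i) = (\<Prod>i\<in>S. tr n (f i))"
  by (induction S rule: infinite_finite_induct) (auto simp: tr_mult)

lemma tr_sum: "tr n (\<Sum>i\<in>S. f i) = (\<Sum>i\<in>S. tr n (f i))"
  by (induction S rule: infinite_finite_induct) (auto simp: tr_add)

lemma tr_tr: "tr m (tr n f) = tr (min m n) f"
  by (rule poly_mapping_eqI) (auto simp: when_def)

lemma tr_perm_pol:
  assumes "\<sigma> permutes {..<n}"
  shows "tr n (perm_pol \<sigma> f) = perm_pol \<sigma> (tr n f)"
proof (rule poly_mapping_eqI)
  fix m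
  have b: "bij \<sigma>" using assms by (rule permutes_bij)
  have "\<sigma> i < n \<longleftrightarrow> i < n" for i
    using permutes_in_image[OF assms, of i] by simp
  then have "Poly_Mapping.keys (act \<sigma> m) \<subseteq> {..<n} \<longleftrightarrow> Poly_Mapping.keys m \<subseteq> {..<n}"
    using b by (auto simp: keys_act) (metis bij_pointE lessThan_iff subset_iff vimageI)
  then show "look (tr n (perm_pol \<sigma> f)) m = look (perm_pol \<sigma> (tr n f)) m"
    using b by simp
qed

subsection \<open>Homogeneous components\<close>

definition hcomp :: "nat \<Rightarrow> mpol \<Rightarrow> mpol" where
  "hcomp d f = Abs_poly_mapping (\<lambda>m. look f m when mdeg m = d)"

lemma look_hcomp [simp]: "look (hcomp d f) m = (look f m when mdeg m = d)"
proof -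
  have "finite {m. (look f m when mdeg m = d) \<noteq> 0}"
    by (rule finite_subset[OF _ finite_lookup[of f]]) auto
  then show ?thesis by (simp add: hcomp_def)
qed

lemma hcomp_zero [simp]: "hcomp d 0 = 0"
  by (rule poly_mapping_eqI) simp

lemma hcomp_add: "hcomp d (f + g) = hcomp d f + hcomp d g"
  by (rule poly_mapping_eqI) (simp add: lookup_add when_add_distrib)

lemma hcomp_diff: "hcomp d (f - g) = hcomp d f - hcomp d g"
  by (rule poly_mapping_eqI) (simp add: lookup_minus when_diff_distrib)

lemma hcomp_single:
  "hcomp d (Poly_Mapping.single m c) = (Poly_Mapping.single m c when mdeg m = d)"
  by (rule poly_mapping_eqI) (auto simp: lookup_single when_def)

lemma hcomp_Var_mult: "hcomp (Suc d) (Var i * f) = Var i * hcomp d f"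
  by (rule additive_eqI[of "\<lambda>f. hcomp (Suc d) (Var i * f)"])
    (auto simp: hcomp_add algebra_simps hcomp_single Var_def mult_single when_def mdeg_add)

lemma hcomp_perm_pol: "bij \<sigma> \<Longrightarrow> hcomp d (perm_pol \<sigma> f) = perm_pol \<sigma> (hcomp d f)"
  by (rule poly_mapping_eqI) (simp add: mdeg_act)

section \<open>Demazure operators\<close>

abbreviation adj :: "nat \<Rightarrow> nat \<Rightarrow> nat" where
  "adj i \<equiv> Transposition.transpose i (Suc i)"

abbreviation ps :: "nat \<Rightarrow> mpol \<Rightarrow> mpol" where
  "ps i \<equiv> perm_pol (adj i)"

lemma pol_of_fract_to_fract [simp]: "pol_of_fract (to_fract p) = p"
  unfolding pol_of_fract_def by (rule the_equality) auto

lemma ps_ps [simp]: "ps i (ps i f) = f"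
  by (simp add: perm_pol_comp)

lemma ps_Var: "ps i (Var j) = Var (adj i j)"
  by (simp add: perm_pol_Var)

lemma ps_Var_far [simp]: "j \<noteq> i \<Longrightarrow> j \<noteq> Suc i \<Longrightarrow> ps i (Var j) = Var j"
  by (simp add: perm_pol_Var)

lemma ps_Var_same [simp]: "ps i (Var i) = Var (Suc i)" "ps i (Var (Suc i)) = Var i"
  by (simp_all add: perm_pol_Var)

lemma ps_mult: "ps i (f * g) = ps i f * ps i g"
  by (simp add: perm_pol_mult)

lemma ps_diff: "ps i (f - g) = ps i f - ps i g"
  by (simp add: perm_pol_diff)

lemma ps_add: "ps i (f + g) = ps i f + ps i g"
  by (simp add: perm_pol_add)

lemma ps_commute:
  assumes "Suc i < j"
  shows "ps i (ps j f) = ps j (ps i f)"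
proof -
  have "adj i \<circ> adj j = adj j \<circ> adj i"
    using assms by (auto simp: fun_eq_iff transpose_def)
  then show ?thesis by (simp add: perm_pol_comp)
qed

lemma ps_braid: "ps i (ps (Suc i) (ps i f)) = ps (Suc i) (ps i (ps (Suc i) f))"
proof -
  have "adj i \<circ> (adj (Suc i) \<circ> adj i) = adj (Suc i) \<circ> (adj i \<circ> adj (Suc i))"
    by (auto simp: fun_eq_iff transpose_def)
  then show ?thesis by (simp add: perm_pol_comp bij_comp)
qed

text \<open>Modulo \<open>x\<^sub>i - x\<^sub>i\<^sub>+\<^sub>1\<close> the transposition fixes all variables. The \<open>h\<close> for which it fixes \<open>h\<close> form a
  subring, which contains the constants and the variables and hence everything. For \<open>h = x\<^sub>i f\<close>
  this says that \<open>\<xi>\<^sub>i f\<close> is a polynomial.\<close>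

lemma Var_diff_dvd: "Var i - Var (Suc i) dvd h - ps i h"
proof (induction h rule: mpol_generated)
  case (Var j)
  have "Var i - Var (Suc i) dvd Var (Suc i) - Var i"
    by (metis dvd_refl dvd_minus_iff minus_diff_eq)
  then show ?case
    by (cases "j = i"; cases "j = Suc i") auto
next
  case (add f g)
  have "f + g - ps i (f + g) = (f - ps i f) + (g - ps i g)"
    by (simp add: ps_add)
  with add show ?case by (simp only: dvd_add)
next
  case (mult f g)
  have "f * g - ps i (f * g) = f * (g - ps i g) + (f - ps i f) * ps i g"
    by (simp add: ps_mult algebra_simps)
  then show ?case using mult by simp
qed simp

text \<open>The equation determines \<open>g\<close>, since \<open>x\<^sub>i - x\<^sub>i\<^sub>+\<^sub>1\<close> is not a zero divisor. Together with \<open>xi_eq\<close> it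
  makes it possible to compute with \<open>\<xi>\<^sub>i\<close> inside the polynomial ring.\<close>

lemma xi_eqI:
  assumes "(Var i - Var (Suc i)) * g = Var i * f - Var (Suc i) * ps i f"
  shows "xi i f = g"
proof -
  have "to_fract (Var i * f - Var (Suc i) * ps i f) / to_fract (Var i - Var (Suc i)) = to_fract g"
    unfolding assms[symmetric] to_fract_mult by (simp del: to_fract_diff)
  then show ?thesis by (simp only: xi_def pol_of_fract_to_fract)
qed

lemma xi_eq: "(Var i - Var (Suc i)) * xi i f = Var i * f - Var (Suc i) * ps i f"
proof -
  from Var_diff_dvd[of i "Var i * f"] obtain g
    where "Var i * f - ps i (Var i * f) = (Var i - Var (Suc i)) * g" by (rule dvdE)
  then have "(Var i - Var (Suc i)) * g = Var i * f - Var (Suc i) * ps i f"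
    by (simp add: ps_mult)
  then show ?thesis using xi_eqI by metis
qed

lemma ps_xi [simp]: "ps i (xi i f) = xi i f"
proof -
  have "(Var (Suc i) - Var i) * ps i (xi i f) = Var (Suc i) * ps i f - Var i * f"
    using arg_cong[OF xi_eq[of i f], of "ps i"] by (simp add: ps_mult ps_diff)
  then have "(Var i - Var (Suc i)) * ps i (xi i f) = Var i * f - Var (Suc i) * ps i f"
    by (simp add: algebra_simps)
  then show ?thesis by (metis xi_eqI)
qed

lemma xi_invariant: "ps i f = f \<Longrightarrow> xi i f = f"
  by (rule xi_eqI) (simp add: algebra_simps)

lemma ps_xi_far:
  assumes "j \<noteq> i" "j \<noteq> Suc i" "i \<noteq> Suc j"
  shows "ps i (xi j f) = xi j (ps i f)"
proof -
  have c: "ps i (ps j f) = ps j (ps i f)"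
    using assms ps_commute[of i j f] ps_commute[of j i f] by (metis Suc_lessI linorder_neqE_nat)
  show ?thesis
    using arg_cong[OF xi_eq[of j f], of "ps i"] assms c
    by (intro xi_eqI[symmetric]) (simp add: ps_mult ps_diff)
qed

lemma xi_commute:
  assumes "Suc i < j"
  shows "xi i (xi j f) = xi j (xi i f)"
proof (rule xi_eqI)
  have e1: "(Var i - Var (Suc i)) * xi i f = Var i * f - Var (Suc i) * ps i f" by (rule xi_eq)
  have e2: "(Var j - Var (Suc j)) * xi j f = Var j * f - Var (Suc j) * ps j f" by (rule xi_eq)
  have e3: "(Var j - Var (Suc j)) * ps i (xi j f) = Var j * ps i f - Var (Suc j) * ps i (ps j f)"
    using arg_cong[OF e2, of "ps i"] assms by (simp add: ps_mult ps_diff)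
  have e4: "(Var i - Var (Suc i)) * ps j (xi i f) = Var i * ps j f - Var (Suc i) * ps i (ps j f)"
    using arg_cong[OF e1, of "ps j"] assms by (simp add: ps_mult ps_diff ps_commute[symmetric])
  have e5: "(Var j - Var (Suc j)) * xi j (xi i f) = Var j * xi i f - Var (Suc j) * ps j (xi i f)"
    by (rule xi_eq)
  have "(Var j - Var (Suc j)) * ((Var i - Var (Suc i)) * xi j (xi i f))
      = Var j * ((Var i - Var (Suc i)) * xi i f) - Var (Suc j) * ((Var i - Var (Suc i)) * ps j (xi i f))"
    using e5 by algebra
  also have "\<dots> = Var i * ((Var j - Var (Suc j)) * xi j f)
      - Var (Suc i) * ((Var j - Var (Suc j)) * ps i (xi j f))"
    unfolding e1 e2 e3 e4 by algebra
  also have "\<dots> = (Var j - Var (Suc j)) * (Var i * xi j f - Var (Suc i) * ps i (xi j f))"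
    by algebra
  finally show "(Var i - Var (Suc i)) * xi j (xi i f)
      = Var i * xi j f - Var (Suc i) * ps i (xi j f)"
    by simp
qed

text \<open>Multiplied by \<open>(x - y)(x - z)(y - z)\<close>, each side becomes the alternating sum of the six
  permutations of \<open>x\<^sup>2 y f\<close>; the two expansions agree because the transpositions of the variables
  satisfy the braid relation.\<close>

lemma xi_braid: "xi i (xi (Suc i) (xi i f)) = xi (Suc i) (xi i (xi (Suc i) f))"
proof -
  define x y z where xyz: "x = Var i" "y = Var (Suc i)" "z = Var (Suc (Suc i))"
  have [simp]: "ps i x = y" "ps i y = x" "ps i z = z"
    "ps (Suc i) x = x" "ps (Suc i) y = z" "ps (Suc i) z = y"
    by (simp_all add: xyz)
  have ne: "x - y \<noteq> 0" "x - z \<noteq> 0" "y - z \<noteq> 0" by (auto simp: xyz)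
  have E: "(x - y) * xi i h = x * h - y * ps i h"
    "(y - z) * xi (Suc i) h = y * h - z * ps (Suc i) h" for h
    unfolding xyz by (rule xi_eq)+
  note P = ps_mult ps_diff
  define F1 F2 F12 F21 F121 where F: "F1 = ps i f" "F2 = ps (Suc i) f" "F12 = ps i F2"
    "F21 = ps (Suc i) F1" "F121 = ps i F21"
  have F212: "F121 = ps (Suc i) F12" by (simp add: F ps_braid)
  \<comment> \<open>the common expansion of both sides, in terms of the permutations of \<open>f\<close>\<close>
  let ?R = "x * y * (x * f - y * F1) - x * z * (x * F2 - z * F21) + y * z * (y * F12 - z * F121)"
  have L: "(x - y) * (x - z) * (y - z) * xi i (xi (Suc i) (xi i f)) = ?R"
  proof -
    define g where "g = xi i f"
    define h where "h = xi (Suc i) g"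
    define g2 where "g2 = ps (Suc i) g"
    have g: "(x - y) * g = x * f - y * F1" "ps i g = g"
      using E(1)[of f] by (simp_all add: g_def F)
    have g2: "(x - z) * g2 = x * F2 - z * F21"
      using arg_cong[OF g(1), of "ps (Suc i)"] by (simp add: g2_def F P)
    have h: "(y - z) * h = y * g - z * g2"
      using E(2)[of g] by (simp add: h_def g2_def)
    have h1: "(x - z) * ps i h = x * g - z * ps i g2"
      using arg_cong[OF h, of "ps i"] by (simp add: g P)
    have g12: "(y - z) * ps i g2 = y * F12 - z * F121"
      using arg_cong[OF g2, of "ps i"] by (simp add: F P)
    have k: "(x - y) * xi i h = x * h - y * ps i h" by (rule E)
    have "(x - y) * (x - z) * (y - z) * xi i h
        = x * (x - z) * ((y - z) * h) - y * (y - z) * ((x - z) * ps i h)"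
      using k by algebra
    also have "\<dots> = x * y * ((x - y) * g) - x * z * ((x - z) * g2) + y * z * ((y - z) * ps i g2)"
      unfolding h h1 by algebra
    also have "\<dots> = ?R" unfolding g(1) g2 g12 ..
    finally show ?thesis unfolding h_def g_def .
  qed
  have R: "(x - y) * (x - z) * (y - z) * xi (Suc i) (xi i (xi (Suc i) f)) = ?R"
  proof -
    define g where "g = xi (Suc i) f"
    define h where "h = xi i g"
    define g1 where "g1 = ps i g"
    have g: "(y - z) * g = y * f - z * F2" "ps (Suc i) g = g"
      using E(2)[of f] by (simp_all add: g_def F)
    have g1: "(x - z) * g1 = x * F1 - z * F12"
      using arg_cong[OF g(1), of "ps i"] by (simp add: g1_def F P)
    have h: "(x - y) * h = x * g - y * g1"
      using E(1)[of g] by (simp add: h_def g1_def)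
    have h2: "(x - z) * ps (Suc i) h = x * g - z * ps (Suc i) g1"
      using arg_cong[OF h, of "ps (Suc i)"] by (simp add: g P)
    have g21: "(x - y) * ps (Suc i) g1 = x * F21 - y * F121"
      using arg_cong[OF g1, of "ps (Suc i)"] by (simp add: F212 P) (simp add: F)
    have k: "(y - z) * xi (Suc i) h = y * h - z * ps (Suc i) h" by (rule E)
    have "(x - y) * (x - z) * (y - z) * xi (Suc i) h
        = y * (x - z) * ((x - y) * h) - z * (x - y) * ((x - z) * ps (Suc i) h)"
      using k by algebra
    also have "\<dots> = x * x * ((y - z) * g) - y * y * ((x - z) * g1)
        + z * z * ((x - y) * ps (Suc i) g1)"
      unfolding h h2 by algebra
    also have "\<dots> = ?R" unfolding g(1) g1 g21 by algebra
    finally show ?thesis unfolding h_def g_def .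
  qed
  have "((x - y) * (x - z) * (y - z)) * xi i (xi (Suc i) (xi i f))
      = ((x - y) * (x - z) * (y - z)) * xi (Suc i) (xi i (xi (Suc i) f))"
    unfolding L R ..
  then show ?thesis using ne by simp
qed

lemma tr_xi:
  assumes "Suc i < n"
  shows "tr n (xi i f) = xi i (tr n f)"
proof (rule xi_eqI[symmetric])
  have "adj i permutes {..<n}" using assms by (intro permutes_swap_id) auto
  then show "(Var i - Var (Suc i)) * tr n (xi i f) = Var i * tr n f - Var (Suc i) * ps i (tr n f)"
    using arg_cong[OF xi_eq[of i f], of "tr n"] assms
    by (simp add: tr_mult tr_diff tr_Var tr_perm_pol)
qed

text \<open>Taking homogeneous components commutes with permutations of variables and shifts under
  multiplication by a variable, hence it commutes with \<open>\<xi>\<^sub>i\<close>. This makes key polynomials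
  homogeneous, which bounds the degree of their limits.\<close>

lemma hcomp_xi: "hcomp d (xi i f) = xi i (hcomp d f)"
proof (rule xi_eqI[symmetric])
  show "(Var i - Var (Suc i)) * hcomp d (xi i f) = Var i * hcomp d f - Var (Suc i) * ps i (hcomp d f)"
    using arg_cong[OF xi_eq[of i f], of "hcomp (Suc d)"]
    by (simp add: left_diff_distrib hcomp_diff hcomp_Var_mult hcomp_perm_pol)
qed

section \<open>Key polynomials\<close>

lemma length_swap_at [simp]: "length (swap_at i \<alpha>) = length \<alpha>"
  by (simp add: swap_at_def)

lemma nth_swap_at:
  "Suc i < length \<alpha> \<Longrightarrow> j < length \<alpha> \<Longrightarrow> swap_at i \<alpha> ! j = \<alpha> ! adj i j"
  by (auto simp: swap_at_def nth_list_update transpose_def)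

lemma swap_at_swap_at [simp]: "Suc i < length \<alpha> \<Longrightarrow> swap_at i (swap_at i \<alpha>) = \<alpha>"
  by (intro nth_equalityI) (auto simp: nth_swap_at transpose_def)

lemma swap_at_append: "swap_at (length \<alpha>) (\<alpha> @ a # b # \<beta>) = \<alpha> @ b # a # \<beta>"
  by (intro nth_equalityI) (auto simp: nth_swap_at transpose_def nth_append nth_Cons split: nat.splits)

lemma swap_at_append_left: "Suc i < length \<alpha> \<Longrightarrow> swap_at i (\<alpha> @ \<beta>) = swap_at i \<alpha> @ \<beta>"
  by (intro nth_equalityI) (auto simp: nth_swap_at transpose_def nth_append)

lemma sum_list_swap_at: "Suc i < length \<alpha> \<Longrightarrow> sum_list (swap_at i \<alpha>) = sum_list \<alpha>"
  unfolding swap_at_def by (metis Suc_lessD mset_swap sum_mset_sum_list)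

text \<open>Exchanging the entries of an ascent \<open>i\<close> lowers this by \<open>\<alpha>\<^sub>i\<^sub>+\<^sub>1 - \<alpha>\<^sub>i\<close>, so it serves as the
  termination measure for sorting a composition into decreasing order.\<close>

definition weight :: "nat list \<Rightarrow> nat" where
  "weight \<alpha> = (\<Sum>j<length \<alpha>. j * \<alpha> ! j)"

lemma weight_swap_at:
  assumes i: "Suc i < length \<alpha>" "\<alpha> ! i < \<alpha> ! Suc i"
  shows "weight (swap_at i \<alpha>) < weight \<alpha>"
proof -
  let ?S = "{..<length \<alpha>} - {i, Suc i}"
  have split: "(\<Sum>j<length \<alpha>. f j) = f i + f (Suc i) + (\<Sum>j\<in>?S. f j)" for f :: "nat \<Rightarrow> nat"
  proof -
    have "{..<length \<alpha>} = {i, Suc i} \<union> ?S" using i by auto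
    then have "(\<Sum>j<length \<alpha>. f j) = (\<Sum>j\<in>{i, Suc i} \<union> ?S. f j)" by simp
    also have "\<dots> = f i + f (Suc i) + (\<Sum>j\<in>?S. f j)" by (subst sum.union_disjoint) auto
    finally show ?thesis .
  qed
  have eq: "(\<Sum>j\<in>?S. j * swap_at i \<alpha> ! j) = (\<Sum>j\<in>?S. j * \<alpha> ! j)"
    using i by (intro sum.cong) (auto simp: nth_swap_at transpose_def)
  show ?thesis
    unfolding weight_def length_swap_at split eq using i
    by (simp add: nth_swap_at algebra_simps)
qed

lemma sorted_wrt_ge_iff: "sorted_wrt (\<ge>) \<alpha> \<longleftrightarrow> (\<forall>i. Suc i < length \<alpha> \<longrightarrow> \<alpha> ! i \<ge> \<alpha> ! Suc i)"
  for \<alpha> :: "nat list"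
  by (subst sorted_wrt_iff_nth_Suc_transp) (auto simp: transp_def)

abbreviation ascent :: "nat list \<Rightarrow> nat \<Rightarrow> bool" where
  "ascent \<alpha> i \<equiv> Suc i < length \<alpha> \<and> \<alpha> ! i < \<alpha> ! Suc i"

lemma composition_induct [case_names sorted ascent]:
  assumes "\<And>\<alpha>. sorted_wrt (\<ge>) \<alpha> \<Longrightarrow> P \<alpha>"
    and "\<And>\<alpha> i. ascent \<alpha> i \<Longrightarrow> P (swap_at i \<alpha>) \<Longrightarrow> P \<alpha>"
  shows "P (\<alpha> :: nat list)"
proof (induction "weight \<alpha>" arbitrary: \<alpha> rule: less_induct)
  case less
  show ?case
  proof (cases "sorted_wrt (\<ge>) \<alpha>")
    case False
    then obtain i where "ascent \<alpha> i" unfolding sorted_wrt_ge_iff by (auto simp: not_le)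
    then show ?thesis using assms(2) less weight_swap_at by blast
  qed (rule assms(1))
qed

text \<open>The composition is sorted at its first ascent; this choice is arbitrary, as \<open>key_ascent\<close> shows.\<close>

function key :: "nat list \<Rightarrow> mpol" where
  "key \<alpha> = (if \<exists>i. ascent \<alpha> i
     then let i = LEAST i. ascent \<alpha> i in xi i (key (swap_at i \<alpha>)) else xpow \<alpha>)"
  by auto
termination
proof (relation "measure weight", goal_cases)
  case (2 \<alpha> i)
  then have "ascent \<alpha> i" by (metis (mono_tags, lifting) LeastI_ex)
  then show ?case by (simp add: weight_swap_at)
qed simp

declare key.simps [simp del]

lemma key_sorted: "sorted_wrt (\<ge>) \<alpha> \<Longrightarrow> key \<alpha> = xpow \<alpha>"
proof -
  assume "sorted_wrt (\<ge>) \<alpha>"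
  then have "\<not> (\<exists>i. ascent \<alpha> i)" by (auto simp: sorted_wrt_ge_iff not_less)
  then show ?thesis by (subst key.simps) (rule if_not_P)
qed

text \<open>This is local confluence of sorting. Two ascents \<open>i < j\<close> that are not adjacent can be sorted
  in either order, and the operators commute. If \<open>j = i + 1\<close>, three consecutive entries increase
  strictly, both ways of sorting end in their reversal, and the two words in \<open>\<xi>\<^sub>i\<close> and \<open>\<xi>\<^sub>j\<close> are the two
  sides of the braid relation.\<close>

lemma key_ascent: "ascent \<alpha> i \<Longrightarrow> key \<alpha> = xi i (key (swap_at i \<alpha>))"
proof (induction "weight \<alpha>" arbitrary: \<alpha> i rule: less_induct)
  case less
  have IH: "key \<beta> = xi j (key (swap_at j \<beta>))" if "weight \<beta> < weight \<alpha>" "ascent \<beta> j" for \<beta> j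
    using less.hyps that by blast
  have ordered: "xi i (key (swap_at i \<alpha>)) = xi j (key (swap_at j \<alpha>))"
    if i: "ascent \<alpha> i" and j: "ascent \<alpha> j" and ij: "i < j" for i j
  proof (cases "j = Suc i")
    case False
    then have far: "Suc i < j" using ij by simp
    have i': "ascent (swap_at j \<alpha>) i" and j': "ascent (swap_at i \<alpha>) j"
      using i j far by (auto simp: nth_swap_at transpose_def)
    have eq: "swap_at i (swap_at j \<alpha>) = swap_at j (swap_at i \<alpha>)"
      using i j far by (intro nth_equalityI) (auto simp: nth_swap_at transpose_def)
    have "xi i (key (swap_at i \<alpha>)) = xi i (xi j (key (swap_at j (swap_at i \<alpha>))))"
      using IH[OF _ j'] weight_swap_at i by simp
    also have "\<dots> = xi j (xi i (key (swap_at i (swap_at j \<alpha>))))"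
      using xi_commute[OF far] eq by simp
    also have "\<dots> = xi j (key (swap_at j \<alpha>))"
      using IH[OF _ i'] weight_swap_at j by simp
    finally show ?thesis .
  next
    case True
    let ?s = "swap_at i" and ?t = "swap_at (Suc i)"
    have L: "Suc (Suc i) < length \<alpha>" and ab: "\<alpha> ! i < \<alpha> ! Suc i" "\<alpha> ! Suc i < \<alpha> ! Suc (Suc i)"
      using i j True by auto
    have 1: "ascent (?s \<alpha>) (Suc i)" "ascent (?t (?s \<alpha>)) i"
      "ascent (?t \<alpha>) i" "ascent (?s (?t \<alpha>)) (Suc i)"
      using L ab by (auto simp: nth_swap_at transpose_def)
    have eq: "?s (?t (?s \<alpha>)) = ?t (?s (?t \<alpha>))"
      using L by (intro nth_equalityI) (auto simp: nth_swap_at transpose_def)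
    have w: "weight (?s \<alpha>) < weight \<alpha>" "weight (?t \<alpha>) < weight \<alpha>"
      using weight_swap_at i j True by auto
    have w2: "weight (?t (?s \<alpha>)) < weight \<alpha>" "weight (?s (?t \<alpha>)) < weight \<alpha>"
      using w 1 weight_swap_at less_trans by blast+
    have "xi i (key (?s \<alpha>)) = xi i (xi (Suc i) (xi i (key (?s (?t (?s \<alpha>))))))"
      using IH[OF w(1) 1(1)] IH[OF w2(1) 1(2)] by simp
    also have "\<dots> = xi (Suc i) (xi i (xi (Suc i) (key (?t (?s (?t \<alpha>))))))"
      by (simp add: xi_braid eq)
    also have "\<dots> = xi (Suc i) (key (?t \<alpha>))"
      using IH[OF w(2) 1(3)] IH[OF w2(2) 1(4)] by simp
    finally show ?thesis using True by simp
  qed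
  define m where "m = (LEAST i. ascent \<alpha> i)"
  have m: "ascent \<alpha> m" unfolding m_def using less.prems by (rule LeastI)
  have "key \<alpha> = xi m (key (swap_at m \<alpha>))"
    using less.prems by (subst key.simps) (auto simp: Let_def m_def)
  then show ?case
    using ordered[OF m less.prems] ordered[OF less.prems m] by (metis linorder_neqE_nat)
qed

lemma key_family_key: "key_family key"
  unfolding key_family_def
proof (intro conjI allI impI)
  fix \<alpha> :: "nat list" and i
  assume a: "Suc i < length \<alpha> \<and> \<alpha> ! i > \<alpha> ! Suc i"
  then have "ascent (swap_at i \<alpha>) i" by (simp add: nth_swap_at)
  from key_ascent[OF this] show "key (swap_at i \<alpha>) = xi i (key \<alpha>)" using a by simp
qed (rule key_sorted)

lemma key_family_unique: "key_family K \<Longrightarrow> K \<alpha> = key \<alpha>"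
proof (induction \<alpha> rule: composition_induct)
  case (ascent \<alpha> i)
  then have "\<alpha>' ! i > \<alpha>' ! Suc i \<and> Suc i < length \<alpha>'" if "\<alpha>' = swap_at i \<alpha>" for \<alpha>'
    using that by (simp add: nth_swap_at)
  then have "K (swap_at i (swap_at i \<alpha>)) = xi i (K (swap_at i \<alpha>))"
    using ascent.prems unfolding key_family_def by blast
  then show ?case using ascent key_ascent by simp
qed (simp add: key_family_def key_sorted)

lemma key_poly_eq: "key_poly = key"
  unfolding key_poly_def
  by (rule the_equality) (auto simp: key_family_key intro!: ext key_family_unique)

lemma key_poly_sorted: "sorted_wrt (\<ge>) \<alpha> \<Longrightarrow> key_poly \<alpha> = xpow \<alpha>"
  by (simp add: key_poly_eq key_sorted)

lemma key_poly_ascent: "ascent \<alpha> i \<Longrightarrow> key_poly \<alpha> = xi i (key_poly (swap_at i \<alpha>))"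
  by (simp only: key_poly_eq key_ascent)

lemma ps_xpow:
  assumes "Suc i < length \<alpha>" "\<alpha> ! i = \<alpha> ! Suc i"
  shows "ps i (xpow \<alpha>) = xpow \<alpha>"
proof -
  have Vp: "ps i (Var j ^ e) = Var (adj i j) ^ e" for j e
    by (induction e) (auto simp: ps_mult ps_Var)
  have "ps i (xpow \<alpha>) = (\<Prod>j<length \<alpha>. Var (adj i j) ^ (\<alpha> ! j))"
    by (simp add: xpow_def perm_pol_prod Vp)
  also have "\<dots> = (\<Prod>j<length \<alpha>. Var (adj i (adj i j)) ^ (\<alpha> ! adj i j))"
    by (rule prod.reindex_bij_betw[symmetric])
      (use assms in \<open>intro permutes_imp_bij permutes_swap_id, auto\<close>)
  also have "\<dots> = xpow \<alpha>"
    unfolding xpow_def by (rule prod.cong) (use assms in \<open>auto simp: transpose_def\<close>)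
  finally show ?thesis .
qed

text \<open>At an ascent the key polynomial lies in the image of \<open>\<xi>\<^sub>i\<close>. If the two entries are equal, sort at
  another ascent \<open>j\<close>. The delicate case is \<open>j\<close> adjacent to \<open>i\<close>: the three entries concerned are
  \<open>a, a, b\<close> or \<open>a, b, b\<close> with \<open>a < b\<close>, and sorting them gives \<open>\<xi>\<^sub>j \<xi>\<^sub>i f\<close>, where \<open>f\<close> belongs to \<open>b, a, a\<close> or
  \<open>b, b, a\<close> and by induction satisfies \<open>f = \<xi>\<^sub>j f\<close>. The braid relation then turns \<open>\<xi>\<^sub>j \<xi>\<^sub>i \<xi>\<^sub>j f\<close> into an element
  of the image of \<open>\<xi>\<^sub>i\<close>.\<close>

lemma ps_key_poly:
  "Suc i < length \<alpha> \<Longrightarrow> \<alpha> ! i \<le> \<alpha> ! Suc i \<Longrightarrow> ps i (key_poly \<alpha>) = key_poly \<alpha>"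
proof (induction "weight \<alpha>" arbitrary: \<alpha> i rule: less_induct)
  case less
  have IH: "ps i (key_poly \<beta>) = key_poly \<beta>"
    if "weight \<beta> < weight \<alpha>" "Suc i < length \<beta>" "\<beta> ! i \<le> \<beta> ! Suc i" for \<beta> i
    using less.hyps that by blast
  show ?case
  proof (cases "\<alpha> ! i < \<alpha> ! Suc i")
    case True
    then show ?thesis using key_poly_ascent[of i \<alpha>] less.prems by simp
  next
    case False
    then have eq: "\<alpha> ! i = \<alpha> ! Suc i" using less.prems by simp
    show ?thesis
    proof (cases "sorted_wrt (\<ge>) \<alpha>")
      case True
      then show ?thesis using ps_xpow eq less.prems by (simp add: key_poly_sorted)
    next
      case False
      then obtain j where j: "ascent \<alpha> j" unfolding sorted_wrt_ge_iff by (auto simp: not_le)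
      have w: "weight (swap_at j \<alpha>) < weight \<alpha>" using j weight_swap_at by simp
      have "j \<noteq> i" using j eq by auto
      then consider "j = Suc i" | "i = Suc j" | "j \<noteq> i" "j \<noteq> Suc i" "i \<noteq> Suc j" by blast
      then show ?thesis
      proof cases
        case 1
        let ?\<beta> = "swap_at j \<alpha>" and ?\<gamma> = "swap_at i (swap_at j \<alpha>)"
        have a: "ascent ?\<beta> i" using j 1 eq by (simp add: nth_swap_at)
        have w2: "weight ?\<gamma> < weight \<alpha>" using w weight_swap_at[of i ?\<beta>] a by simp
        have "ps j (key_poly ?\<gamma>) = key_poly ?\<gamma>"
          by (rule IH[OF w2]) (use j 1 eq in \<open>auto simp: nth_swap_at\<close>)
        then have inv: "xi j (key_poly ?\<gamma>) = key_poly ?\<gamma>" by (rule xi_invariant)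
        have "key_poly \<alpha> = xi j (xi i (xi j (key_poly ?\<gamma>)))"
          using key_poly_ascent[OF j] key_poly_ascent[OF a] inv by simp
        also have "\<dots> = xi i (xi j (xi i (key_poly ?\<gamma>)))" using 1 by (simp add: xi_braid)
        finally show ?thesis by simp
      next
        case 2
        let ?\<beta> = "swap_at j \<alpha>" and ?\<gamma> = "swap_at i (swap_at j \<alpha>)"
        have a: "ascent ?\<beta> i" using j 2 eq less.prems by (simp add: nth_swap_at)
        have w2: "weight ?\<gamma> < weight \<alpha>" using w weight_swap_at[of i ?\<beta>] a by simp
        have "ps j (key_poly ?\<gamma>) = key_poly ?\<gamma>"
          by (rule IH[OF w2]) (use j 2 eq less.prems in \<open>auto simp: nth_swap_at\<close>)
        then have inv: "xi j (key_poly ?\<gamma>) = key_poly ?\<gamma>" by (rule xi_invariant)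
        have "key_poly \<alpha> = xi j (xi i (xi j (key_poly ?\<gamma>)))"
          using key_poly_ascent[OF j] key_poly_ascent[OF a] inv by simp
        also have "\<dots> = xi i (xi j (xi i (key_poly ?\<gamma>)))" using 2 by (simp add: xi_braid)
        finally show ?thesis by simp
      next
        case 3
        have "ps i (key_poly (swap_at j \<alpha>)) = key_poly (swap_at j \<alpha>)"
          by (rule IH[OF w]) (use j 3 eq less.prems in \<open>auto simp: nth_swap_at transpose_def\<close>)
        then show ?thesis using key_poly_ascent[OF j] ps_xi_far[OF 3] by simp
      qed
    qed
  qed
qed

lemma xpow_append_zero: "xpow (\<alpha> @ [0]) = xpow \<alpha>"
  by (simp add: xpow_def nth_append)

lemma key_poly_append_zero: "key_poly (\<alpha> @ [0]) = key_poly \<alpha>"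
proof (induction \<alpha> rule: composition_induct)
  case (sorted \<alpha>)
  then show ?case by (simp add: key_poly_sorted sorted_wrt_append xpow_append_zero)
next
  case (ascent \<alpha> i)
  then have "ascent (\<alpha> @ [0]) i" by (simp add: nth_append)
  then show ?case
    using ascent key_poly_ascent[of i "\<alpha> @ [0]"] key_poly_ascent[of i \<alpha>]
    by (simp add: swap_at_append_left)
qed

lemma key_poly_append_zeros: "key_poly (\<alpha> @ replicate n 0) = key_poly \<alpha>"
proof (induction n)
  case (Suc n)
  then show ?case
    using key_poly_append_zero[of "\<alpha> @ replicate n 0"]
    by (simp add: replicate_append_same[symmetric])
qed simp

lemma nth_append_mon:
  "Poly_Mapping.nth (\<alpha> @ [a]) = Poly_Mapping.nth \<alpha> + Poly_Mapping.single (length \<alpha>) (a :: nat)"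
  by (rule poly_mapping_eqI)
    (auto simp: lookup_add lookup_single nth_default_def nth_append when_def)

lemma xpow_eq_single: "xpow \<alpha> = Poly_Mapping.single (Poly_Mapping.nth \<alpha>) 1"
proof (induction \<alpha> rule: rev_induct)
  case (snoc a \<alpha>)
  have "xpow (\<alpha> @ [a]) = xpow \<alpha> * Var (length \<alpha>) ^ a"
    by (simp add: xpow_def nth_append)
  then show ?case using snoc by (simp add: nth_append_mon Var_power mult_single)
qed (simp add: xpow_def)

lemma mdeg_nth: "mdeg (Poly_Mapping.nth \<alpha>) = sum_list \<alpha>"
  by (induction \<alpha> rule: rev_induct) (auto simp: nth_append_mon mdeg_add)

lemma tr_key_poly: "length \<alpha> \<le> n \<Longrightarrow> tr n (key_poly \<alpha>) = key_poly \<alpha>"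
proof (induction \<alpha> rule: composition_induct)
  case (sorted \<alpha>)
  have "Poly_Mapping.keys (Poly_Mapping.nth \<alpha>) \<subseteq> {..<n}"
    using sorted(2) by (auto simp: in_keys_iff nth_default_def simp del: keys_nth split: if_splits)
  with sorted(1) show ?case by (simp add: key_poly_sorted xpow_eq_single tr_single del: keys_nth)
next
  case (ascent \<alpha> i)
  then show ?case using key_poly_ascent[of i \<alpha>] tr_xi[of i n] by simp
qed

lemma hcomp_key_poly: "hcomp (sum_list \<alpha>) (key_poly \<alpha>) = key_poly \<alpha>"
proof (induction \<alpha> rule: composition_induct)
  case (sorted \<alpha>)
  then show ?case by (simp add: key_poly_sorted xpow_eq_single hcomp_single mdeg_nth)
next
  case (ascent \<alpha> i)
  then show ?case using key_poly_ascent[of i \<alpha>] hcomp_xi by (simp add: sum_list_swap_at)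
qed

section \<open>Antisymmetrisation\<close>

definition pairs :: "nat \<Rightarrow> nat \<Rightarrow> (nat \<times> nat) set" where
  "pairs k n = {(i, j). k \<le> i \<and> i < j \<and> j < n}"

lemma pairs_Suc: "k \<le> n \<Longrightarrow> pairs k (Suc n) = pairs k n \<union> (\<lambda>i. (i, n)) ` {k..<n}"
  by (auto simp: pairs_def less_Suc_eq)

lemma finite_pairs [simp]: "finite (pairs k n)"
  by (rule finite_subset[of _ "{..<n} \<times> {..<n}"]) (auto simp: pairs_def)

lemma prod_pairs_Suc:
  assumes "k \<le> n"
  shows "(\<Prod>(i, j)\<in>pairs k (Suc n). f i j)
    = (\<Prod>(i, j)\<in>pairs k n. f i j) * (\<Prod>i\<in>{k..<n}. f i n :: 'a::comm_monoid_mult)"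
proof -
  have "pairs k n \<inter> (\<lambda>i. (i, n)) ` {k..<n} = {}" by (auto simp: pairs_def)
  then show ?thesis
    unfolding pairs_Suc[OF assms]
    by (subst prod.union_disjoint) (auto simp: prod.reindex inj_on_def)
qed

lemma permutes_subinterval: "\<sigma> permutes {k..<n} \<Longrightarrow> (n::nat) \<le> m \<Longrightarrow> \<sigma> permutes {k..<m}"
  by (erule permutes_subset) auto

lemma permutes_lessThan: "\<sigma> permutes {k..<n::nat} \<Longrightarrow> \<sigma> permutes {..<n}"
  by (erule permutes_subset) auto

lemma permutation_interval: "\<sigma> permutes {k..<n::nat} \<Longrightarrow> permutation \<sigma>"
  by (rule permutation_permutes[THEN iffD2]) auto

text \<open>If \<open>\<sigma> i = n\<close> for some \<open>i < n\<close>, the pair \<open>(i, n)\<close> contributes the factor \<open>z n = 0\<close>. The remaining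
  permutations fix \<open>n\<close>, and their factors for the pairs \<open>(i, n)\<close> multiply to the product of all
  \<open>z i\<close>. The weight \<open>G\<close> makes the lemma apply both to the Vandermonde identity and to the
  numerator of the symmetriser.\<close>

lemma signed_sum_last_zero:
  fixes z :: "nat \<Rightarrow> 'a::comm_ring_1"
  assumes kn: "k \<le> n" and z: "z n = 0"
  shows "(\<Sum>\<sigma> | \<sigma> permutes {k..<Suc n}.
            of_int (sign \<sigma>) * (\<Prod>(i, j)\<in>pairs k (Suc n). z (\<sigma> i)) * G \<sigma>)
       = (\<Prod>i\<in>{k..<n}. z i) *
         (\<Sum>\<sigma> | \<sigma> permutes {k..<n}. of_int (sign \<sigma>) * (\<Prod>(i, j)\<in>pairs k n. z (\<sigma> i)) * G \<sigma>)"
    (is "?L = ?c * ?R")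
proof -
  have "?L = (\<Sum>\<sigma> | \<sigma> permutes {k..<n}.
      of_int (sign \<sigma>) * (\<Prod>(i, j)\<in>pairs k (Suc n). z (\<sigma> i)) * G \<sigma>)"
  proof (rule sum.mono_neutral_right)
    show "{\<sigma>. \<sigma> permutes {k..<n}} \<subseteq> {\<sigma>. \<sigma> permutes {k..<Suc n}}"
      using permutes_subinterval by (metis (mono_tags) Collect_mono le_add2 plus_1_eq_Suc)
    show "\<forall>\<sigma>\<in>{\<sigma>. \<sigma> permutes {k..<Suc n}} - {\<sigma>. \<sigma> permutes {k..<n}}.
        of_int (sign \<sigma>) * (\<Prod>(i, j)\<in>pairs k (Suc n). z (\<sigma> i)) * G \<sigma> = 0"
    proof
      fix \<sigma> assume "\<sigma> \<in> {\<sigma>. \<sigma> permutes {k..<Suc n}} - {\<sigma>. \<sigma> permutes {k..<n}}"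
      then have s: "\<sigma> permutes {k..<Suc n}" and ns: "\<not> \<sigma> permutes {k..<n}" by auto
      have "\<sigma> n \<noteq> n"
      proof
        assume "\<sigma> n = n"
        then have "\<sigma> permutes {k..<n}"
          by (intro permutes_superset[OF s]) (auto simp: less_Suc_eq)
        with ns show False ..
      qed
      define i where "i = inv \<sigma> n"
      have i: "\<sigma> i = n" unfolding i_def using permutes_inverses(1)[OF s] .
      have "i \<in> {k..<Suc n}" using permutes_in_image[OF s, of i] i kn by simp
      with \<open>\<sigma> n \<noteq> n\<close> i have "(i, n) \<in> pairs k (Suc n)" by (auto simp: pairs_def less_Suc_eq)
      then have "(\<Prod>(i, j)\<in>pairs k (Suc n). z (\<sigma> i)) = 0"
        using i z by (intro prod_zero) (auto intro!: bexI[of _ "(i, n)"])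
      then show "of_int (sign \<sigma>) * (\<Prod>(i, j)\<in>pairs k (Suc n). z (\<sigma> i)) * G \<sigma> = 0" by simp
    qed
  qed (simp add: finite_permutations)
  also have "\<dots> = ?c * ?R"
    unfolding sum_distrib_left
  proof (rule sum.cong)
    fix \<sigma> assume "\<sigma> \<in> {\<sigma>. \<sigma> permutes {k..<n}}"
    then have s: "\<sigma> permutes {k..<n}" by simp
    have "(\<Prod>i\<in>{k..<n}. z (\<sigma> i)) = ?c"
      by (rule prod.reindex_bij_betw[OF permutes_imp_bij[OF s]])
    then show "of_int (sign \<sigma>) * (\<Prod>(i, j)\<in>pairs k (Suc n). z (\<sigma> i)) * G \<sigma>
        = ?c * (of_int (sign \<sigma>) * (\<Prod>(i, j)\<in>pairs k n. z (\<sigma> i)) * G \<sigma>)"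
      by (simp add: prod_pairs_Suc[OF kn] mult_ac)
  qed simp
  finally show ?thesis .
qed

subsection \<open>The Vandermonde identity\<close>

text \<open>As \<open>i\<close> is the first component of \<open>n - 1 - i\<close> pairs, this is the Leibniz expansion of the
  Vandermonde determinant with entries \<open>z j\<close> to the power \<open>n - 1 - i\<close>.\<close>

definition vdm :: "nat \<Rightarrow> nat \<Rightarrow> (nat \<Rightarrow> 'a::comm_ring_1) \<Rightarrow> 'a" where
  "vdm k n z = (\<Sum>\<sigma> | \<sigma> permutes {k..<n}. of_int (sign \<sigma>) * (\<Prod>(i, j)\<in>pairs k n. z (\<sigma> i)))"

lemma vdm_last_zero: "k \<le> n \<Longrightarrow> z n = 0 \<Longrightarrow> vdm k (Suc n) z = (\<Prod>i\<in>{k..<n}. z i) * vdm k n z"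
  using signed_sum_last_zero[of k n z "\<lambda>_. 1"] by (simp add: vdm_def)

lemma vdm_cong: "(\<And>i. k \<le> i \<Longrightarrow> i < n \<Longrightarrow> z i = z' i) \<Longrightarrow> vdm k n z = vdm k n z'"
  unfolding vdm_def
proof (intro sum.cong arg_cong2[of _ _ _ _ "(*)"] prod.cong refl, clarsimp)
  fix \<sigma> i j assume "\<And>i. k \<le> i \<Longrightarrow> i < n \<Longrightarrow> z i = z' i" "\<sigma> permutes {k..<n}" "(i, j) \<in> pairs k n"
  then show "z (\<sigma> i) = z' (\<sigma> i)" using permutes_in_image[of \<sigma> "{k..<n}" i] by (auto simp: pairs_def)
qed

text \<open>Composing \<open>\<sigma>\<close> with the transposition of \<open>a\<close> and \<open>b\<close> changes the sign of each summand and nothing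
  else, so the sum equals its own negative.\<close>

lemma vdm_repeated:
  fixes z :: "nat \<Rightarrow> 'a::{idom, ring_char_0}"
  assumes "a \<in> {k..<n}" "b \<in> {k..<n}" "a \<noteq> b" "z a = z b"
  shows "vdm k n z = 0"
proof -
  let ?t = "Transposition.transpose a b"
  have t: "?t permutes {k..<n}" using assms by (intro permutes_swap_id) auto
  have zt: "z (?t i) = z i" for i using assms by (auto simp: transpose_def)
  have "vdm k n z = (\<Sum>\<sigma> | \<sigma> permutes {k..<n}.
      of_int (sign (?t \<circ> \<sigma>)) * (\<Prod>(i, j)\<in>pairs k n. z ((?t \<circ> \<sigma>) i)))"
    unfolding vdm_def by (rule setum_permutations_compose_left[OF t])
  also have "\<dots> = (\<Sum>\<sigma> | \<sigma> permutes {k..<n}. - (of_int (sign \<sigma>) * (\<Prod>(i, j)\<in>pairs k n. z (\<sigma> i))))"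
  proof (rule sum.cong)
    fix \<sigma> assume "\<sigma> \<in> {\<sigma>. \<sigma> permutes {k..<n}}"
    then have "permutation \<sigma>" using permutation_interval by auto
    then show "of_int (sign (?t \<circ> \<sigma>)) * (\<Prod>(i, j)\<in>pairs k n. z ((?t \<circ> \<sigma>) i))
        = - (of_int (sign \<sigma>) * (\<Prod>(i, j)\<in>pairs k n. z (\<sigma> i)))"
      using assms by (simp add: zt sign_compose permutation_swap_id sign_swap_id)
  qed simp
  also have "\<dots> = - vdm k n z" by (simp add: vdm_def sum_negf)
  finally show ?thesis by simp
qed

text \<open>In the induction step, replace \<open>z n\<close> by an indeterminate \<open>y\<close>. The determinant becomes a polynomial
  of degree at most \<open>n - k\<close> in \<open>y\<close>, and so is its expected value. They agree at the \<open>n - k + 1\<close> points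
  \<open>y = 0\<close> (\<open>vdm_last_zero\<close>) and \<open>y = z i\<close> with \<open>k \<le> i < n\<close>, where both vanish (\<open>vdm_repeated\<close>).\<close>

lemma vandermonde:
  fixes z :: "nat \<Rightarrow> 'a::{idom, ring_char_0}"
  assumes "k \<le> n" "inj_on z {k..<n}" "\<And>i. k \<le> i \<Longrightarrow> i < n \<Longrightarrow> z i \<noteq> 0"
  shows "vdm k n z = (\<Prod>(i, j)\<in>pairs k n. z i - z j)"
  using assms
proof (induction n rule: dec_induct)
  case base
  have "pairs k k = {}" by (auto simp: pairs_def)
  then show ?case by (simp add: vdm_def)
next
  case (step n)
  have IH: "vdm k n z = (\<Prod>(i, j)\<in>pairs k n. z i - z j)"
    using step by (intro step.IH) (auto intro: inj_on_subset)
  \<comment> \<open>\<open>p\<close> is the determinant with \<open>z n\<close> replaced by the indeterminate, \<open>q\<close> its expected value.\<close>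
  define Z where "Z i = (if i = n then [:0, 1:] else [:z i:])" for i
  define p where "p = vdm k (Suc n) Z"
  define q where "q = (\<Prod>i\<in>{k..<n}. [:z i, - 1:]) * [:vdm k n z:]"
  have pp: "poly p y = vdm k (Suc n) (z(n := y))" for y
  proof -
    have "poly p y = vdm k (Suc n) (\<lambda>i. poly (Z i) y)"
      by (simp add: p_def vdm_def poly_sum poly_prod case_prod_unfold)
    also have "(\<lambda>i. poly (Z i) y) = z(n := y)" by (auto simp: Z_def)
    finally show ?thesis .
  qed
  have pq: "poly q y = (\<Prod>i\<in>{k..<n}. z i - y) * vdm k n z" for y
    by (simp add: q_def poly_prod)
  have "p = q"
  proof (rule poly_eqI_degree)
    let ?A = "insert 0 (z ` {k..<n})"
    have "0 \<notin> z ` {k..<n}" using step.prems(2) by (metis atLeastLessThan_iff imageE less_SucI)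
    moreover have "card (z ` {k..<n}) = n - k"
      using step.prems(1) by (subst card_image) (auto intro: inj_on_subset)
    ultimately have cA: "card ?A = Suc (n - k)" by simp
    have dZ: "degree (Z i) = (if i = n then 1 else 0)" for i by (simp add: Z_def)
    \<comment> \<open>In the summand of \<open>\<sigma>\<close> the indeterminate comes from the pairs whose first component is
      mapped to \<open>n\<close>.\<close>
    have "degree p \<le> n - k"
      unfolding p_def vdm_def
    proof (rule degree_sum_le)
      fix \<sigma> assume "\<sigma> \<in> {\<sigma>. \<sigma> permutes {k..<Suc n}}"
      then have s: "\<sigma> permutes {k..<Suc n}" by simp
      have "degree (\<Prod>(i, j)\<in>pairs k (Suc n). Z (\<sigma> i))
          \<le> (\<Sum>(i, j)\<in>pairs k (Suc n). degree (Z (\<sigma> i)))"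
        using degree_prod_sum_le[of "pairs k (Suc n)" "\<lambda>(i, j). Z (\<sigma> i)"]
        by (simp add: case_prod_unfold comp_def)
      also have "\<dots> = (\<Sum>x\<in>pairs k (Suc n). if \<sigma> (fst x) = n then 1 else 0)"
        by (rule sum.cong) (auto simp: dZ)
      also have "\<dots> = card {x \<in> pairs k (Suc n). \<sigma> (fst x) = n}"
        unfolding card_eq_sum by (rule sum.inter_filter[symmetric]) simp
      also have "\<dots> \<le> card ({inv \<sigma> n} \<times> {Suc k..<Suc n})"
        using permutes_inverses(2)[OF s] by (intro card_mono) (auto simp: pairs_def)
      also have "\<dots> = n - k" by simp
      finally have "degree (\<Prod>(i, j)\<in>pairs k (Suc n). Z (\<sigma> i)) \<le> n - k" .
      then show "degree (of_int (sign \<sigma>) * (\<Prod>(i, j)\<in>pairs k (Suc n). Z (\<sigma> i))) \<le> n - k"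
        using degree_mult_le[of "of_int (sign \<sigma>)" "\<Prod>(i, j)\<in>pairs k (Suc n). Z (\<sigma> i)"] by simp
    qed (simp add: finite_permutations)
    then show "degree p < card ?A" by (simp add: cA)
    have "degree q \<le> (\<Sum>i\<in>{k..<n}. degree [:z i, - 1:]) + 0"
      unfolding q_def
      by (rule order.trans[OF degree_mult_le])
        (use degree_prod_sum_le[of "{k..<n}" "\<lambda>i. [:z i, - 1:]"] in \<open>simp add: comp_def\<close>)
    then show "degree q < card ?A" by (simp add: cA)
    show "poly p y = poly q y" if "y \<in> ?A" for y
    proof (cases "y = 0")
      case True
      have "vdm k (Suc n) (z(n := 0)) = (\<Prod>i\<in>{k..<n}. (z(n := 0)) i) * vdm k n (z(n := 0))"
        using step.hyps by (intro vdm_last_zero) auto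
      also have "(\<Prod>i\<in>{k..<n}. (z(n := 0)) i) = (\<Prod>i\<in>{k..<n}. z i)" by (rule prod.cong) auto
      also have "vdm k n (z(n := 0)) = vdm k n z" by (rule vdm_cong) auto
      finally show ?thesis using True by (simp add: pp pq del: fun_upd_apply)
    next
      case False
      with that obtain r where r: "r \<in> {k..<n}" "y = z r" by auto
      have "vdm k (Suc n) (z(n := y)) = 0"
        by (rule vdm_repeated[of r _ _ n]) (use r in auto)
      moreover have "(\<Prod>i\<in>{k..<n}. z i - y) = 0"
        using r by (intro prod_zero) auto
      ultimately show ?thesis by (simp add: pp pq)
    qed
  qed
  then have "vdm k (Suc n) z = (\<Prod>i\<in>{k..<n}. z i - z n) * vdm k n z"
    using pp[of "z n"] pq[of "z n"] by simp
  then show ?case using step.hyps by (simp add: IH prod_pairs_Suc)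
qed

subsection \<open>The numerator and the denominator of the symmetriser\<close>

definition Alt :: "nat \<Rightarrow> nat \<Rightarrow> mpol \<Rightarrow> mpol" where
  "Alt k n h = (\<Sum>\<sigma> | \<sigma> permutes {k..<n}. of_int (sign \<sigma>) * perm_pol \<sigma> h)"

definition rho :: "nat \<Rightarrow> nat \<Rightarrow> mpol" where
  "rho k n = (\<Prod>(i, j)\<in>pairs k n. Var i)"

definition Delta :: "nat \<Rightarrow> nat \<Rightarrow> mpol" where
  "Delta k n = (\<Prod>(i, j)\<in>pairs k n. Var i - Var j)"

lemma of_int_eq_Const: "of_int c = Const (of_int c)"
  by (simp add: Const_def)

lemma perm_pol_of_int [simp]: "bij \<sigma> \<Longrightarrow> perm_pol \<sigma> (of_int c) = of_int c"
  by (simp add: of_int_eq_Const)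

lemma tr_of_int [simp]: "tr n (of_int c) = of_int c"
  by (simp add: of_int_eq_Const)

lemma perm_pol_sum: "bij \<sigma> \<Longrightarrow> perm_pol \<sigma> (\<Sum>i\<in>S. f i) = (\<Sum>i\<in>S. perm_pol \<sigma> (f i))"
  by (induction S rule: infinite_finite_induct) (auto simp: perm_pol_add)

lemma Alt_compose_right:
  assumes t: "\<tau> permutes {k..<n}"
  shows "Alt k n (perm_pol \<tau> h) = of_int (sign \<tau>) * Alt k n h"
proof -
  have "of_int (sign \<tau>) * Alt k n h = of_int (sign \<tau>) * (\<Sum>\<sigma> | \<sigma> permutes {k..<n}.
      of_int (sign (\<sigma> \<circ> \<tau>)) * perm_pol (\<sigma> \<circ> \<tau>) h)"
    unfolding Alt_def by (subst sum_permutations_compose_right[OF t]) simp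
  also have "\<dots> = Alt k n (perm_pol \<tau> h)"
    unfolding Alt_def sum_distrib_left
  proof (rule sum.cong)
    fix \<sigma> assume "\<sigma> \<in> {\<sigma>. \<sigma> permutes {k..<n}}"
    then have s: "\<sigma> permutes {k..<n}" by simp
    have "sign \<tau> * sign (\<sigma> \<circ> \<tau>) = sign \<sigma>"
      using s t by (simp add: sign_compose permutation_interval)
    then have "of_int (sign \<tau>) * of_int (sign (\<sigma> \<circ> \<tau>)) = (of_int (sign \<sigma>) :: mpol)"
      by (metis of_int_mult)
    then show "of_int (sign \<tau>) * (of_int (sign (\<sigma> \<circ> \<tau>)) * perm_pol (\<sigma> \<circ> \<tau>) h)
        = of_int (sign \<sigma>) * perm_pol \<sigma> (perm_pol \<tau> h)"
      using s t by (simp add: perm_pol_comp permutes_bij mult.assoc[symmetric])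
  qed simp
  finally show ?thesis by simp
qed

lemma perm_pol_Alt:
  assumes t: "\<tau> permutes {k..<n}"
  shows "perm_pol \<tau> (Alt k n h) = of_int (sign \<tau>) * Alt k n h"
proof -
  have "of_int (sign \<tau>) * Alt k n h = of_int (sign \<tau>) * (\<Sum>\<sigma> | \<sigma> permutes {k..<n}.
      of_int (sign (\<tau> \<circ> \<sigma>)) * perm_pol (\<tau> \<circ> \<sigma>) h)"
    unfolding Alt_def by (subst setum_permutations_compose_left[OF t]) simp
  also have "\<dots> = perm_pol \<tau> (Alt k n h)"
    unfolding Alt_def sum_distrib_left perm_pol_sum[OF permutes_bij[OF t]]
  proof (rule sum.cong)
    fix \<sigma> assume "\<sigma> \<in> {\<sigma>. \<sigma> permutes {k..<n}}"
    then have s: "\<sigma> permutes {k..<n}" by simp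
    have "sign \<tau> * sign (\<tau> \<circ> \<sigma>) = sign \<sigma>"
      using s t by (simp add: sign_compose permutation_interval)
    then have "of_int (sign \<tau>) * of_int (sign (\<tau> \<circ> \<sigma>)) = (of_int (sign \<sigma>) :: mpol)"
      by (metis of_int_mult)
    then show "of_int (sign \<tau>) * (of_int (sign (\<tau> \<circ> \<sigma>)) * perm_pol (\<tau> \<circ> \<sigma>) h)
        = perm_pol \<tau> (of_int (sign \<sigma>) * perm_pol \<sigma> h)"
      using s t by (simp add: perm_pol_comp perm_pol_mult permutes_bij mult.assoc[symmetric])
  qed simp
  finally show ?thesis by simp
qed

lemma Alt_diff: "Alt k n (f - g) = Alt k n f - Alt k n g"
  unfolding Alt_def sum_subtractf[symmetric]
  by (rule sum.cong) (auto simp: perm_pol_diff permutes_bij right_diff_distrib)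

lemma Alt_rho_mult:
  "Alt k n (rho k n * f) = (\<Sum>\<sigma> | \<sigma> permutes {k..<n}.
     of_int (sign \<sigma>) * (\<Prod>(i, j)\<in>pairs k n. Var (\<sigma> i)) * perm_pol \<sigma> f)"
  unfolding Alt_def
  by (rule sum.cong)
    (auto simp: rho_def perm_pol_mult perm_pol_prod permutes_bij case_prod_unfold perm_pol_Var mult.assoc)

lemma Alt_rho:
  assumes "k \<le> n"
  shows "Alt k n (rho k n) = Delta k n"
proof -
  have "Alt k n (rho k n) = Alt k n (rho k n * 1)" by simp
  also have "\<dots> = vdm k n Var"
    unfolding Alt_rho_mult vdm_def by (rule sum.cong) (auto simp: permutes_bij)
  also have "\<dots> = Delta k n"
    unfolding Delta_def using assms by (intro vandermonde) (auto simp: inj_on_def)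
  finally show ?thesis .
qed

lemma Delta_neq_0 [simp]: "Delta k n \<noteq> 0"
  unfolding Delta_def prod_zero_iff[OF finite_pairs] by (auto simp: pairs_def)

lemma perm_pol_Delta:
  "k \<le> n \<Longrightarrow> \<sigma> permutes {k..<n} \<Longrightarrow> perm_pol \<sigma> (Delta k n) = of_int (sign \<sigma>) * Delta k n"
  by (metis Alt_rho perm_pol_Alt)

text \<open>The equation \<open>W\<^sub>k f = g\<close> in \<open>n\<close> variables, with its denominators cleared.\<close>

definition W_rel :: "nat \<Rightarrow> nat \<Rightarrow> mpol \<Rightarrow> mpol \<Rightarrow> bool" where
  "W_rel k n f g \<longleftrightarrow> Delta k n * g = Alt k n (rho k n * f)"

text \<open>The denominators of the summands are the permutations of \<open>\<Delta>\<close>, which differ from \<open>\<Delta>\<close> only in sign;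
  over the common denominator \<open>\<Delta>\<close> the numerators add up to the antisymmetrisation.\<close>

lemma W_fin_eqI:
  assumes kn: "k \<le> n" and "W_rel k n f g"
  shows "W_fin k n f = g"
proof -
  have rel: "Delta k n * g = Alt k n (rho k n * f)" using assms(2) by (simp add: W_rel_def)
  have D0: "to_fract (Delta k n) \<noteq> 0" by simp
  have "(\<Sum>\<sigma> | \<sigma> permutes {k..<n}. to_fract (perm_pol \<sigma> f) *
        (\<Prod>(i, j)\<in>{(i, j). k \<le> i \<and> i < j \<and> j < n}.
           1 / (1 - to_fract (Var (\<sigma> j)) / to_fract (Var (\<sigma> i)))))
     = (\<Sum>\<sigma> | \<sigma> permutes {k..<n}. to_fract (of_int (sign \<sigma>) *
         (\<Prod>(i, j)\<in>pairs k n. Var (\<sigma> i)) * perm_pol \<sigma> f) / to_fract (Delta k n))"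
  proof (rule sum.cong)
    fix \<sigma> assume "\<sigma> \<in> {\<sigma>. \<sigma> permutes {k..<n}}"
    then have s: "\<sigma> permutes {k..<n}" by simp
    have "(\<Prod>(i, j)\<in>pairs k n. 1 / (1 - to_fract (Var (\<sigma> j)) / to_fract (Var (\<sigma> i))))
        = (\<Prod>(i, j)\<in>pairs k n. to_fract (Var (\<sigma> i)) / to_fract (Var (\<sigma> i) - Var (\<sigma> j)))"
      by (rule prod.cong) (auto simp: divide_simps)
    also have "\<dots> = to_fract (\<Prod>(i, j)\<in>pairs k n. Var (\<sigma> i))
        / to_fract (\<Prod>(i, j)\<in>pairs k n. Var (\<sigma> i) - Var (\<sigma> j))"
    proof -
      have tp: "to_fract (prod h S) = (\<Prod>x\<in>S. to_fract (h x))" for h :: "nat \<times> nat \<Rightarrow> mpol" and S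
        by (induction S rule: infinite_finite_induct) auto
      show ?thesis unfolding tp by (simp add: case_prod_unfold prod_dividef)
    qed
    also have "(\<Prod>(i, j)\<in>pairs k n. Var (\<sigma> i) - Var (\<sigma> j)) = perm_pol \<sigma> (Delta k n)"
      using permutes_bij[OF s]
      by (simp add: Delta_def perm_pol_prod case_prod_unfold perm_pol_diff perm_pol_Var)
    also have "\<dots> = of_int (sign \<sigma>) * Delta k n" by (rule perm_pol_Delta[OF kn s])
    finally have P: "(\<Prod>(i, j)\<in>pairs k n. 1 / (1 - to_fract (Var (\<sigma> j)) / to_fract (Var (\<sigma> i))))
        = to_fract (\<Prod>(i, j)\<in>pairs k n. Var (\<sigma> i)) / to_fract (of_int (sign \<sigma>) * Delta k n)" .
    show "to_fract (perm_pol \<sigma> f) *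
        (\<Prod>(i, j)\<in>{(i, j). k \<le> i \<and> i < j \<and> j < n}.
           1 / (1 - to_fract (Var (\<sigma> j)) / to_fract (Var (\<sigma> i))))
      = to_fract (of_int (sign \<sigma>) * (\<Prod>(i, j)\<in>pairs k n. Var (\<sigma> i)) * perm_pol \<sigma> f)
         / to_fract (Delta k n)"
      unfolding pairs_def[symmetric] P
      by (cases \<sigma> rule: sign_cases) (simp_all add: mult_ac)
  qed simp
  also have "\<dots> = to_fract (Alt k n (rho k n * f)) / to_fract (Delta k n)"
    unfolding Alt_rho_mult to_fract_sum sum_divide_distrib ..
  also have "\<dots> = to_fract g"
    unfolding rel[symmetric] to_fract_mult using D0 by simp
  finally show ?thesis by (simp add: W_fin_def)
qed

subsection \<open>Symmetric functions and Demazure operators under the symmetriser\<close>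

text \<open>The adjacent transpositions generate the group: the transposition of \<open>a\<close> and \<open>b + 1\<close> is the
  conjugate of that of \<open>a\<close> and \<open>b\<close> by the adjacent transposition at \<open>b\<close>.\<close>

lemma perm_pol_invariantI:
  assumes adj: "\<And>i. k \<le> i \<Longrightarrow> Suc i < n \<Longrightarrow> ps i f = f" and s: "\<sigma> permutes {k..<n}"
  shows "perm_pol \<sigma> f = f"
proof -
  have less: "perm_pol (Transposition.transpose a (Suc (a + d))) f = f"
    if "k \<le> a" "Suc (a + d) < n" for a d
    using that
  proof (induction d)
    case 0
    then show ?case using adj by simp
  next
    case (Suc d)
    let ?b = "Suc (a + d)"
    have "Transposition.transpose a (Suc ?b) = adj ?b \<circ> (Transposition.transpose a ?b \<circ> adj ?b)"
      by (auto simp: fun_eq_iff transpose_def)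
    then have "perm_pol (Transposition.transpose a (Suc ?b)) f
        = ps ?b (perm_pol (Transposition.transpose a ?b) (ps ?b f))"
      by (simp add: perm_pol_comp bij_comp)
    also have "\<dots> = f" using Suc adj[of ?b] by simp
    finally show ?case by simp
  qed
  have tr: "perm_pol (Transposition.transpose a b) f = f"
    if "a \<in> {k..<n}" "b \<in> {k..<n}" "a \<noteq> b" for a b
  proof (cases "a < b")
    case True
    then obtain d where "b = Suc (a + d)" using less_imp_Suc_add by blast
    then show ?thesis using less[of a d] that by simp
  next
    case False
    then have "b < a" using that by simp
    then obtain d where "a = Suc (b + d)" using less_imp_Suc_add by blast
    then show ?thesis using less[of b d] that by (simp add: transpose_commute)
  qed
  show ?thesis
    using s finite_atLeastLessThan
  proof (induction rule: permutes_induct)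
    case (swap a b p)
    have "perm_pol (Transposition.transpose a b \<circ> p) f
        = perm_pol (Transposition.transpose a b) (perm_pol p f)"
      by (rule perm_pol_comp[symmetric]) (use swap in \<open>auto intro: permutes_bij\<close>)
    also have "\<dots> = f" using swap tr[of a b] by simp
    finally show ?case .
  qed (rule perm_pol_id)
qed

text \<open>A symmetric factor can be taken out of the antisymmetrisation, and what is left is the
  Vandermonde determinant \<open>Alt(x\<^sup>\<rho>) = \<Delta>\<close>.\<close>

lemma W_rel_symmetric:
  assumes "k \<le> n" and inv: "\<And>i. k \<le> i \<Longrightarrow> Suc i < n \<Longrightarrow> ps i f = f"
  shows "W_rel k n f f"
proof -
  have "Alt k n (rho k n * f) = (\<Sum>\<sigma> | \<sigma> permutes {k..<n}. of_int (sign \<sigma>) * perm_pol \<sigma> (rho k n) * f)"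
    unfolding Alt_def
    by (rule sum.cong)
      (auto simp: perm_pol_mult permutes_bij mult.assoc perm_pol_invariantI[OF inv])
  also have "\<dots> = Alt k n (rho k n) * f"
    by (simp add: Alt_def sum_distrib_right)
  finally show ?thesis using assms(1) by (simp add: W_rel_def Alt_rho)
qed

text \<open>The monomial \<open>x\<^sup>\<rho>\<close> is \<open>x\<^sub>i\<close> times a monomial in which \<open>x\<^sub>i\<close> and \<open>x\<^sub>i\<^sub>+\<^sub>1\<close> have equal exponents, and
  \<open>x\<^sub>i (\<xi>\<^sub>i f - f)\<close> is invariant under \<open>s\<^sub>i\<close> by the equation defining \<open>\<xi>\<^sub>i\<close>. So the difference of the two
  arguments is invariant under \<open>s\<^sub>i\<close> and is annihilated by antisymmetrisation.\<close>

lemma Alt_rho_xi: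
  assumes i: "k \<le> i" "Suc i < n"
  shows "Alt k n (rho k n * xi i f) = Alt k n (rho k n * f)"
proof -
  define e where "e = (\<Prod>(a, b)\<in>pairs k n - {(i, Suc i)}. Var a)"
  have "(i, Suc i) \<in> pairs k n" using i by (auto simp: pairs_def)
  then have rho: "rho k n = Var i * e"
    unfolding rho_def e_def by (subst prod.remove) auto
  have e: "ps i e = e"
  proof -
    let ?h = "\<lambda>(a, b). (adj i a, adj i b)" and ?S = "pairs k n - {(i, Suc i)}"
    have into: "?h x \<in> ?S" if "x \<in> ?S" for x
      using that i by (auto simp: pairs_def transpose_def split: if_splits)
    have "bij_betw ?h ?S ?S"
      by (rule bij_betw_byWitness[where f' = ?h]) (use into in auto)
    then have "(\<Prod>x\<in>?S. (\<lambda>(a, b). Var a) (?h x)) = e"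
      unfolding e_def by (rule prod.reindex_bij_betw)
    then show ?thesis by (simp add: e_def perm_pol_prod case_prod_unfold ps_Var)
  qed
  let ?d = "rho k n * xi i f - rho k n * f"
  have "Var i * (xi i f - f) = Var (Suc i) * (xi i f - ps i f)"
    using xi_eq[of i f] by (simp add: algebra_simps)
  then have "ps i ?d = ?d"
    by (simp add: rho ps_mult ps_diff e mult.left_commute mult.assoc
        right_diff_distrib[symmetric])
  moreover have "Alt k n (ps i ?d) = - Alt k n ?d"
    using i by (subst Alt_compose_right) (auto intro!: permutes_swap_id simp: sign_swap_id)
  ultimately have "Alt k n ?d = 0" by simp
  then show ?thesis by (simp add: Alt_diff)
qed

subsection \<open>Compatibility with truncation\<close>

lemma tr_Delta:
  assumes "k \<le> n"
  shows "tr n (Delta k (Suc n)) = (\<Prod>i\<in>{k..<n}. Var i) * Delta k n"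
proof -
  have "tr n (Delta k n) = Delta k n"
    unfolding Delta_def tr_prod
    by (rule prod.cong) (auto simp: pairs_def tr_diff tr_Var)
  then show ?thesis
    using assms unfolding Delta_def
    by (simp add: prod_pairs_Suc tr_mult tr_prod tr_diff tr_Var mult.commute)
qed

lemma tr_Alt_rho:
  assumes kn: "k \<le> n"
  shows "tr n (Alt k (Suc n) (rho k (Suc n) * f))
    = (\<Prod>i\<in>{k..<n}. Var i) * Alt k n (rho k n * tr n f)"
proof -
  have "tr n (Alt k (Suc n) (rho k (Suc n) * f)) = (\<Sum>\<sigma> | \<sigma> permutes {k..<Suc n}.
      of_int (sign \<sigma>) * (\<Prod>(i, j)\<in>pairs k (Suc n). tr n (Var (\<sigma> i))) * tr n (perm_pol \<sigma> f))"
    unfolding Alt_rho_mult tr_sum tr_mult tr_prod by (simp add: case_prod_unfold)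
  also have "\<dots> = (\<Prod>i\<in>{k..<n}. tr n (Var i)) * (\<Sum>\<sigma> | \<sigma> permutes {k..<n}.
      of_int (sign \<sigma>) * (\<Prod>(i, j)\<in>pairs k n. tr n (Var (\<sigma> i))) * tr n (perm_pol \<sigma> f))"
    by (rule signed_sum_last_zero[OF kn]) (simp add: tr_Var)
  also have "(\<Prod>i\<in>{k..<n}. tr n (Var i)) = (\<Prod>i\<in>{k..<n}. Var i)"
    by (rule prod.cong) (auto simp: tr_Var)
  also have "(\<Sum>\<sigma> | \<sigma> permutes {k..<n}. of_int (sign \<sigma>) *
      (\<Prod>(i, j)\<in>pairs k n. tr n (Var (\<sigma> i))) * tr n (perm_pol \<sigma> f)) = Alt k n (rho k n * tr n f)"
    unfolding Alt_rho_mult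
  proof (rule sum.cong)
    fix \<sigma> assume "\<sigma> \<in> {\<sigma>. \<sigma> permutes {k..<n}}"
    then have s: "\<sigma> permutes {k..<n}" by simp
    have "\<sigma> i < n" if "(i, j) \<in> pairs k n" for i j
      using that permutes_in_image[OF s, of i] by (auto simp: pairs_def)
    then have "(\<Prod>(i, j)\<in>pairs k n. tr n (Var (\<sigma> i))) = (\<Prod>(i, j)\<in>pairs k n. Var (\<sigma> i))"
      by (intro prod.cong) (auto simp: tr_Var)
    then show "of_int (sign \<sigma>) * (\<Prod>(i, j)\<in>pairs k n. tr n (Var (\<sigma> i))) * tr n (perm_pol \<sigma> f)
        = of_int (sign \<sigma>) * (\<Prod>(i, j)\<in>pairs k n. Var (\<sigma> i)) * perm_pol \<sigma> (tr n f)"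
      by (simp add: tr_perm_pol[OF permutes_lessThan[OF s]])
  qed simp
  finally show ?thesis .
qed

text \<open>When the last variable is set to zero, numerator and denominator both acquire the factor
  \<open>x\<^sub>k\<^sub>+\<^sub>1 \<cdots> x\<^sub>n\<close>, which cancels.\<close>

lemma W_rel_tr:
  assumes "k \<le> n" "W_rel k (Suc n) f g"
  shows "W_rel k n (tr n f) (tr n g)"
proof -
  let ?c = "\<Prod>i\<in>{k..<n}. Var i"
  have "?c * (Delta k n * tr n g) = ?c * Alt k n (rho k n * tr n f)"
    using arg_cong[OF assms(2)[unfolded W_rel_def], of "tr n"] assms(1)
    by (simp add: tr_mult tr_Delta tr_Alt_rho mult.assoc)
  then show ?thesis by (simp add: W_rel_def prod_zero_iff)
qed

lemma W_rel_tr_le: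
  assumes "k \<le> m" "m \<le> n" "W_rel k n f g" "tr n f = f" "tr n g = g"
  shows "W_rel k m (tr m f) (tr m g)"
  using assms(2,1,3-)
proof (induction n arbitrary: f g rule: dec_induct)
  case (step n)
  have "W_rel k n (tr n f) (tr n g)" using step by (intro W_rel_tr) auto
  from step.IH[OF _ this] step.hyps step.prems(1)
  show ?case by (simp add: tr_tr min_absorb1)
qed simp

subsection \<open>The symmetriser on key polynomials\<close>

text \<open>Moving \<open>a\<close> past a smaller entry applies some \<open>\<xi>\<^sub>i\<close> to the key polynomial, which the symmetriser
  does not see; moving it past an equal entry does not change the composition.\<close>

lemma Alt_rho_key_poly_move:
  assumes "\<forall>x\<in>set xs. x \<le> a" "k \<le> length \<mu>" "length \<mu> + length xs + length ys < n"
  shows "Alt k n (rho k n * key_poly (\<mu> @ a # xs @ ys)) = Alt k n (rho k n * key_poly (\<mu> @ xs @ a # ys))"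
  using assms
proof (induction xs arbitrary: \<mu>)
  case (Cons x xs)
  have "Alt k n (rho k n * key_poly (\<mu> @ a # x # xs @ ys))
      = Alt k n (rho k n * key_poly (\<mu> @ x # a # xs @ ys))"
  proof (cases "x = a")
    case False
    then have "ascent (\<mu> @ x # a # xs @ ys) (length \<mu>)" using Cons.prems by (simp add: nth_append)
    from key_poly_ascent[OF this]
    have "key_poly (\<mu> @ x # a # xs @ ys) = xi (length \<mu>) (key_poly (\<mu> @ a # x # xs @ ys))"
      by (simp only: swap_at_append)
    then show ?thesis using Cons.prems by (simp add: Alt_rho_xi)
  qed simp
  also have "\<dots> = Alt k n (rho k n * key_poly (\<mu> @ x # xs @ a # ys))"
    using Cons.IH[of "\<mu> @ [x]"] Cons.prems by simp
  finally show ?case by simp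
qed simp

lemma ps_key_poly_sorted_tail:
  assumes "sorted xs" "length \<mu> \<le> i" "Suc i < length \<mu> + length xs"
  shows "ps i (key_poly (\<mu> @ xs)) = key_poly (\<mu> @ xs)"
proof (rule ps_key_poly)
  have "xs ! (i - length \<mu>) \<le> xs ! Suc (i - length \<mu>)"
    using assms by (intro sorted_nth_mono) auto
  then show "(\<mu> @ xs) ! i \<le> (\<mu> @ xs) ! Suc i"
    using assms by (simp add: nth_append Suc_diff_le)
qed (use assms in simp)

lemma W_rel_key_poly:
  assumes "sorted (xs @ [a])"
  shows "W_rel (length \<mu>) (length \<mu> + length xs + 1) (key_poly (\<mu> @ a # xs)) (key_poly (\<mu> @ xs @ [a]))"
proof -
  let ?\<beta> = "\<mu> @ xs @ [a]" and ?k = "length \<mu>" and ?n = "length \<mu> + length xs + 1"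
  have "W_rel ?k ?n (key_poly ?\<beta>) (key_poly ?\<beta>)"
    by (intro W_rel_symmetric ps_key_poly_sorted_tail assms) auto
  moreover have "Alt ?k ?n (rho ?k ?n * key_poly (\<mu> @ a # xs)) = Alt ?k ?n (rho ?k ?n * key_poly ?\<beta>)"
    using Alt_rho_key_poly_move[of xs a ?k \<mu> "[]" ?n] assms by (simp add: sorted_append)
  ultimately show ?thesis by (simp add: W_rel_def)
qed

section \<open>Almost symmetric series\<close>

definition bounded_series :: "nat \<Rightarrow> ser \<Rightarrow> bool" where
  "bounded_series d f \<longleftrightarrow> (\<forall>m. f m \<noteq> 0 \<longrightarrow> mdeg m < d)"

definition symmetric_from :: "nat \<Rightarrow> ser \<Rightarrow> bool" where
  "symmetric_from k f \<longleftrightarrow> (\<forall>n \<sigma> m. \<sigma> permutes {k..<n} \<longrightarrow> f (act \<sigma> m) = f m)"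

subsection \<open>Truncation of series\<close>

lemma finite_bounded_monomials: "finite {m :: mon. Poly_Mapping.keys m \<subseteq> {..<n} \<and> mdeg m < d}"
proof (rule finite_imageD)
  let ?h = "\<lambda>m :: mon. map (look m) [0..<n]"
  show "finite (?h ` {m. Poly_Mapping.keys m \<subseteq> {..<n} \<and> mdeg m < d})"
  proof (rule finite_subset)
    show "finite {xs :: nat list. set xs \<subseteq> {..<d} \<and> length xs = n}"
      by (rule finite_lists_length_eq) simp
    show "?h ` {m. Poly_Mapping.keys m \<subseteq> {..<n} \<and> mdeg m < d}
        \<subseteq> {xs. set xs \<subseteq> {..<d} \<and> length xs = n}"
      by (auto intro: le_less_trans[OF lookup_le_mdeg])
  qed
  show "inj_on ?h {m. Poly_Mapping.keys m \<subseteq> {..<n} \<and> mdeg m < d}"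
  proof (rule inj_onI, rule poly_mapping_eqI)
    fix a b :: mon and i
    assume a: "a \<in> {m. Poly_Mapping.keys m \<subseteq> {..<n} \<and> mdeg m < d}"
      and b: "b \<in> {m. Poly_Mapping.keys m \<subseteq> {..<n} \<and> mdeg m < d}" and e: "?h a = ?h b"
    show "look a i = look b i"
    proof (cases "i < n")
      case True
      then show ?thesis using arg_cong[OF e, of "\<lambda>xs. xs ! i"] by simp
    next
      case False
      then have "i \<notin> Poly_Mapping.keys a" "i \<notin> Poly_Mapping.keys b" using a b by auto
      then show ?thesis by (simp add: in_keys_iff)
    qed
  qed
qed

lemma look_trunc:
  assumes "bounded_series d f"
  shows "look (trunc n f) m = (f m when Poly_Mapping.keys m \<subseteq> {..<n})"
proof -
  have "finite {m. (f m when Poly_Mapping.keys m \<subseteq> {..<n}) \<noteq> 0}"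
    by (rule finite_subset[OF _ finite_bounded_monomials[of n d]])
      (use assms in \<open>auto simp: bounded_series_def\<close>)
  then show ?thesis by (simp add: trunc_def)
qed

lemma monomial_in_finitely_many_variables:
  obtains n where "n \<ge> k" "Poly_Mapping.keys (m :: mon) \<subseteq> {..<n}"
proof
  show "Poly_Mapping.keys m \<subseteq> {..<max k (Poly_Mapping.degree m)}"
    by (auto dest!: in_keys_less_degree)
qed simp

lemma bounded_series_eqI:
  assumes "bounded_series d f" "bounded_series d' g" "\<And>n. n \<ge> k \<Longrightarrow> trunc n f = trunc n g"
  shows "f = g"
proof
  fix m :: mon
  obtain n where "n \<ge> k" "Poly_Mapping.keys m \<subseteq> {..<n}"
    using monomial_in_finitely_many_variables[of k m] by blast
  then show "f m = g m"
    using look_trunc[OF assms(1), of n m] look_trunc[OF assms(2), of n m] assms(3)[of n] by simp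
qed

subsection \<open>Multiplication by a monomial\<close>

lemma mon_times_add [simp]: "mon_times a f (a + m) = f m"
  by (simp add: mon_times_def)

lemma mon_times_not_divisible: "(\<And>m'. m \<noteq> a + m') \<Longrightarrow> mon_times a f m = 0"
  unfolding mon_times_def by (intro sum.neutral) auto

lemma mon_times_cases:
  obtains (div) m' where "m = a + m'" | (not_div) "\<And>f. mon_times a f m = 0" "\<And>m'. m \<noteq> a + m'"
  using mon_times_not_divisible by blast

lemma mon_times_zero [simp]: "mon_times 0 f = f"
  using mon_times_add[of 0 f] by auto

lemma mon_times_mon_times: "mon_times a (mon_times b f) = mon_times (a + b) f"
proof
  fix m
  show "mon_times a (mon_times b f) m = mon_times (a + b) f m"
  proof (cases m a rule: mon_times_cases)
    case (div m')
    show ?thesis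
    proof (cases m' b rule: mon_times_cases)
      case (div m'')
      then have "m = (a + b) + m''" using \<open>m = a + m'\<close> by (simp add: add.assoc)
      then show ?thesis using mon_times_add[of a _ m'] \<open>m = a + m'\<close> div by (metis mon_times_add)
    next
      case not_div
      then have "m \<noteq> (a + b) + m''" for m'' using div by (simp add: add.assoc)
      then show ?thesis using div not_div by (simp add: mon_times_not_divisible)
    qed
  next
    case not_div
    then have "m \<noteq> (a + b) + m''" for m'' by (simp add: add.assoc)
    then show ?thesis using not_div by (simp add: mon_times_not_divisible)
  qed
qed

lemma look_single_times: "look (Poly_Mapping.single a c * p) m = c * mon_times a (look p) m"
proof (rule additive_eqI[of "\<lambda>p. look (Poly_Mapping.single a c * p) m"])
  show "c * mon_times a (look (f + g)) m = c * mon_times a (look f) m + c * mon_times a (look g) m"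
    for f g :: mpol
    by (cases m a rule: mon_times_cases) (auto simp: lookup_add distrib_left)
  show "look (Poly_Mapping.single a c * Poly_Mapping.single b d) m
      = c * mon_times a (look (Poly_Mapping.single b d)) m" for b d
    by (cases m a rule: mon_times_cases) (auto simp: mult_single lookup_single when_def)
  show "look (Poly_Mapping.single a c * 0) m = c * mon_times a (look 0) m"
    by (cases m a rule: mon_times_cases) auto
qed (auto simp: lookup_add algebra_simps)

subsection \<open>Membership in the space of almost symmetric functions\<close>

definition restr :: "nat set \<Rightarrow> mon \<Rightarrow> mon" where
  "restr S m = Abs_poly_mapping (\<lambda>i. look m i when i \<in> S)"

lemma look_restr [simp]: "look (restr S m) i = (look m i when i \<in> S)"
proof -
  have "finite {i. (look m i when i \<in> S) \<noteq> 0}"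
    by (rule finite_subset[OF _ finite_lookup[of m]]) (auto simp: when_def split: if_splits)
  then show ?thesis by (simp add: restr_def)
qed

lemma restr_split: "restr {..<k} m + restr {k..} m = m"
  by (rule poly_mapping_eqI) (auto simp: lookup_add when_def)

lemma restr_eq:
  assumes "Poly_Mapping.keys a \<subseteq> {..<k}" "Poly_Mapping.keys b \<subseteq> {k..}"
  shows "restr {..<k} (a + b) = a"
proof (rule poly_mapping_eqI)
  fix i
  show "look (restr {..<k} (a + b)) i = look a i"
    using assms in_keys_iff[of i a] in_keys_iff[of i b] by (auto simp: lookup_add when_def)
qed

text \<open>Collect the monomials of \<open>f\<close> according to their exponents in the first \<open>k\<close> variables. The bound
  on the degree leaves finitely many classes, and each gives a symmetric function in the other
  variables.\<close>

lemma P_partI: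
  assumes bd: "bounded_series d f" and sym: "symmetric_from k f"
  shows "f \<in> P_part k"
proof -
  define A where "A = {a :: mon. Poly_Mapping.keys a \<subseteq> {..<k} \<and> mdeg a < d}"
  define g where "g a m = (f (a + m) when Poly_Mapping.keys m \<subseteq> {k..})" for a m
  have Lam: "g a \<in> Lam k" if a: "Poly_Mapping.keys a \<subseteq> {..<k}" for a
  proof -
    have "mdeg m \<le> d" if "g a m \<noteq> 0" for m
      using that bd by (force simp: g_def bounded_series_def mdeg_add)
    moreover have "g a (act \<sigma> m) = g a m" if s: "\<sigma> permutes {k..<n}" for n \<sigma> m
    proof -
      have b: "bij \<sigma>" using s by (rule permutes_bij)
      have fixed: "\<sigma> i = i" if "i < k" for i using that permutes_not_in[OF s, of i] by simp
      have "act \<sigma> a = a"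
      proof (rule poly_mapping_eqI)
        fix i
        show "look (act \<sigma> a) i = look a i"
        proof (cases "i < k")
          case False
          then have "\<not> \<sigma> i < k" using permutes_in_image[OF s, of i] permutes_not_in[OF s, of i] by auto
          then have "i \<notin> Poly_Mapping.keys a" "\<sigma> i \<notin> Poly_Mapping.keys a" using False a by auto
          then show ?thesis using b by (simp add: in_keys_iff)
        qed (use b fixed in simp)
      qed
      then have 1: "f (a + act \<sigma> m) = f (a + m)"
        using sym s act_add[OF b, of a m] unfolding symmetric_from_def by metis
      have ge: "k \<le> \<sigma> i \<longleftrightarrow> k \<le> i" for i
        using permutes_in_image[OF s, of i] permutes_not_in[OF s, of i] fixed[of i]
        by (cases "i \<in> {k..<n}") auto
      have "Poly_Mapping.keys (act \<sigma> m) \<subseteq> {k..} \<longleftrightarrow> Poly_Mapping.keys m \<subseteq> {k..}"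
        using b ge by (auto simp: keys_act) (metis atLeast_iff bij_pointE subset_iff vimageI)
      with 1 show ?thesis by (simp add: g_def)
    qed
    ultimately show ?thesis
      unfolding Lam_def mdeg_def[symmetric] by (auto simp: g_def)
  qed
  have summand: "mon_times a (g a) m = (if a = restr {..<k} m then f m else 0)"
    if a: "Poly_Mapping.keys a \<subseteq> {..<k}" for a m
  proof (cases "a = restr {..<k} m")
    case True
    have "Poly_Mapping.keys (restr {k..} m) \<subseteq> {k..}"
      by (auto simp: in_keys_iff when_def split: if_splits)
    then have "mon_times a (g a) (a + restr {k..} m) = f (a + restr {k..} m)"
      by (simp add: g_def)
    then show ?thesis using True by (simp add: restr_split)
  next
    case False
    show ?thesis
    proof (cases m a rule: mon_times_cases)
      case (div m')
      then have "\<not> Poly_Mapping.keys m' \<subseteq> {k..}" using restr_eq[OF a, of m'] False by auto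
      then show ?thesis using div False by (simp add: g_def)
    qed (use False in simp)
  qed
  have fin: "finite A" unfolding A_def by (rule finite_bounded_monomials)
  have "f m = (\<Sum>a\<in>A. mon_times a (g a) m)" for m
  proof -
    have "(\<Sum>a\<in>A. mon_times a (g a) m) = (\<Sum>a\<in>A. if a = restr {..<k} m then f m else 0)"
      by (rule sum.cong) (auto simp: summand A_def)
    also have "\<dots> = (if restr {..<k} m \<in> A then f m else 0)"
      using fin by simp
    also have "\<dots> = f m"
    proof (cases "f m = 0")
      case False
      then have "mdeg m < d" using bd by (auto simp: bounded_series_def)
      then have "mdeg (restr {..<k} m) < d"
        using mdeg_add[of "restr {..<k} m" "restr {k..} m"] by (simp add: restr_split)
      then have "restr {..<k} m \<in> A"
        by (auto simp: A_def in_keys_iff when_def split: if_splits)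
      then show ?thesis by simp
    qed simp
    finally show ?thesis by simp
  qed
  then show ?thesis
    unfolding P_part_def using fin Lam
    by (intro CollectI exI[of _ A] exI[of _ g]) (auto simp: A_def)
qed

text \<open>The bound makes truncations of almost symmetric functions genuine polynomials, so that such a
  function is determined by its truncations (\<open>bounded_series_eqI\<close>).\<close>

lemma P_as_bounded:
  assumes "f \<in> P_as"
  obtains d where "bounded_series d f"
proof -
  from assms obtain k A g where A: "finite A" "\<forall>a\<in>A. Poly_Mapping.keys a \<subseteq> {..<k} \<and> g a \<in> Lam k"
    and f: "f = (\<lambda>m. \<Sum>a\<in>A. mon_times a (g a) m)"
    unfolding P_as_def P_part_def by blast
  have "\<exists>d. \<forall>m. g a m \<noteq> 0 \<longrightarrow> mdeg m \<le> d" if "a \<in> A" for a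
    using A(2) that unfolding Lam_def mdeg_def[symmetric] by blast
  then obtain d where d: "\<And>a m. a \<in> A \<Longrightarrow> g a m \<noteq> 0 \<Longrightarrow> mdeg m \<le> d a" by metis
  have "bounded_series (Suc (\<Sum>a\<in>A. mdeg a + d a)) f"
    unfolding bounded_series_def
  proof (intro allI impI)
    fix m assume "f m \<noteq> 0"
    then obtain a where a: "a \<in> A" "mon_times a (g a) m \<noteq> 0"
      unfolding f by (meson sum.not_neutral_contains_not_neutral)
    then obtain m' where m': "m = a + m'" using mon_times_not_divisible by blast
    then have "mdeg m \<le> mdeg a + d a" using a d by (simp add: mdeg_add)
    also have "\<dots> \<le> (\<Sum>a\<in>A. mdeg a + d a)"
      using A(1) a(1) by (intro member_le_sum) auto
    finally show "mdeg m < Suc (\<Sum>a\<in>A. mdeg a + d a)" by simp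
  qed
  then show thesis by (rule that)
qed

subsection \<open>Combinations of products of monomials and monomial symmetric functions\<close>

text \<open>A list of terms, possibly with repetitions, makes sums of combinations concatenations.\<close>

definition spanned :: "ser \<Rightarrow> bool" where
  "spanned f \<longleftrightarrow> (\<exists>ts. (\<forall>(\<alpha>, \<nu>, c)\<in>set ts. (\<alpha>, \<nu>) \<in> Sig) \<and>
     f = (\<lambda>m. \<Sum>(\<alpha>, \<nu>, c)\<leftarrow>ts. c * mon_times (Poly_Mapping.nth \<alpha>) (msym \<nu>) m))"

lemma spanned_zero: "spanned (\<lambda>_. 0)"
  unfolding spanned_def by (intro exI[of _ "[]"]) auto

lemma spanned_add: "spanned f \<Longrightarrow> spanned g \<Longrightarrow> spanned (\<lambda>m. f m + g m)"
  unfolding spanned_def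
proof (elim exE conjE)
  fix ts us
  assume "\<forall>(\<alpha>, \<nu>, c)\<in>set ts. (\<alpha>, \<nu>) \<in> Sig" "\<forall>(\<alpha>, \<nu>, c)\<in>set us. (\<alpha>, \<nu>) \<in> Sig"
    "f = (\<lambda>m. \<Sum>(\<alpha>, \<nu>, c)\<leftarrow>ts. c * mon_times (Poly_Mapping.nth \<alpha>) (msym \<nu>) m)"
    "g = (\<lambda>m. \<Sum>(\<alpha>, \<nu>, c)\<leftarrow>us. c * mon_times (Poly_Mapping.nth \<alpha>) (msym \<nu>) m)"
  then show "\<exists>ts. (\<forall>(\<alpha>, \<nu>, c)\<in>set ts. (\<alpha>, \<nu>) \<in> Sig) \<and> (\<lambda>m. f m + g m) =
      (\<lambda>m. \<Sum>(\<alpha>, \<nu>, c)\<leftarrow>ts. c * mon_times (Poly_Mapping.nth \<alpha>) (msym \<nu>) m)"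
    by (intro exI[of _ "ts @ us"]) auto
qed

lemma spanned_sum:
  assumes "finite S" "\<And>x. x \<in> S \<Longrightarrow> spanned (f x)"
  shows "spanned (\<lambda>m. \<Sum>x\<in>S. f x m)"
  using assms
  by (induction S rule: finite_induct) (auto intro: spanned_zero spanned_add)

lemma reduced_composition_of_monomial:
  obtains \<alpha> where "reduced \<alpha>" "Poly_Mapping.nth \<alpha> = (a :: mon)"
proof
  let ?\<alpha> = "map (look a) [0..<Poly_Mapping.degree a]"
  show "reduced ?\<alpha>"
  proof (cases "Poly_Mapping.degree a = 0")
    case False
    then have "look a (Poly_Mapping.degree a - 1) \<noteq> 0"
      using degree_greater_zero_in_keys[of a] unfolding in_keys_iff by blast
    moreover obtain e where "Poly_Mapping.degree a = Suc e" using False not0_implies_Suc by blast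
    ultimately show ?thesis by (simp add: reduced_def)
  qed (simp add: reduced_def)
  show "Poly_Mapping.nth ?\<alpha> = a"
    by (rule nth_idem)
qed

lemma spanned_term:
  assumes "is_partition \<nu>"
  shows "spanned (\<lambda>m. c * mon_times a (msym \<nu>) m)"
proof -
  obtain \<alpha> where "reduced \<alpha>" "Poly_Mapping.nth \<alpha> = a" by (rule reduced_composition_of_monomial)
  then show ?thesis
    unfolding spanned_def using assms by (intro exI[of _ "[(\<alpha>, \<nu>, c)]"]) (auto simp: Sig_def)
qed

lemma mon_times_sum_list:
  "mon_times a (\<lambda>m. \<Sum>x\<leftarrow>xs. F x m) = (\<lambda>m. \<Sum>x\<leftarrow>xs. mon_times a (F x) m)"
proof
  fix m
  show "mon_times a (\<lambda>m. \<Sum>x\<leftarrow>xs. F x m) m = (\<Sum>x\<leftarrow>xs. mon_times a (F x) m)"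
  proof (cases m a rule: mon_times_cases)
    case not_div
    then show ?thesis by (induction xs) auto
  qed simp
qed

lemma mon_times_scale: "mon_times a (\<lambda>m. c * f m) m = c * mon_times a f m"
  by (cases m a rule: mon_times_cases) auto

lemma spanned_mon_times:
  assumes "spanned f"
  shows "spanned (mon_times a f)"
proof -
  from assms obtain ts where ts: "\<forall>(\<alpha>, \<nu>, c)\<in>set ts. (\<alpha>, \<nu>) \<in> Sig"
    and f: "f = (\<lambda>m. \<Sum>(\<alpha>, \<nu>, c)\<leftarrow>ts. c * mon_times (Poly_Mapping.nth \<alpha>) (msym \<nu>) m)"
    unfolding spanned_def by blast
  define F where "F x = (\<lambda>m. snd (snd x) * mon_times (Poly_Mapping.nth (fst x)) (msym (fst (snd x))) m)"
    for x :: "nat list \<times> nat list \<times> qt"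
  have f': "f = (\<lambda>m. \<Sum>x\<leftarrow>ts. F x m)" unfolding f F_def by (simp add: case_prod_unfold)
  have 1: "spanned (mon_times a (F x))" if "x \<in> set ts" for x
  proof -
    have "mon_times a (F x)
        = (\<lambda>m. snd (snd x) * mon_times (a + Poly_Mapping.nth (fst x)) (msym (fst (snd x))) m)"
      by (auto simp: F_def mon_times_scale mon_times_mon_times[symmetric])
    moreover have "is_partition (fst (snd x))" using ts that by (auto simp: Sig_def)
    ultimately show ?thesis using spanned_term by simp
  qed
  have "spanned (\<lambda>m. \<Sum>x\<leftarrow>xs. mon_times a (F x) m)" if "set xs \<subseteq> set ts" for xs
    using that by (induction xs) (simp_all add: spanned_zero spanned_add 1 del: split_paired_All)
  then show ?thesis unfolding f' mon_times_sum_list by blast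
qed

subsection \<open>Spanning: symmetric series\<close>

text \<open>The multiset of nonzero exponents: \<open>msym \<nu>\<close> is the indicator function of \<open>exps m = mset \<nu>\<close>.\<close>

definition exps :: "mon \<Rightarrow> nat multiset" where
  "exps m = image_mset (look m) (mset_set (Poly_Mapping.keys m))"

lemma exps_list:
  assumes "Poly_Mapping.keys m \<subseteq> {..<n}"
  shows "exps m = filter_mset (\<lambda>e. e \<noteq> 0) (mset (map (look m) [0..<n]))"
proof -
  have "{i \<in> {0..<n}. look m i \<noteq> 0} = Poly_Mapping.keys m"
    using assms by (auto simp: in_keys_iff)
  moreover have "filter_mset (\<lambda>e. e \<noteq> 0) (image_mset (look m) (mset_set {0..<n}))
      = image_mset (look m) (mset_set {i \<in> {0..<n}. look m i \<noteq> 0})"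
    by (simp add: filter_mset_image_mset)
  ultimately show ?thesis by (simp add: exps_def)
qed

lemma exps_nth:
  assumes "is_partition \<nu>"
  shows "exps (Poly_Mapping.nth \<nu>) = mset \<nu>"
proof -
  have "Poly_Mapping.keys (Poly_Mapping.nth \<nu>) \<subseteq> {..<length \<nu>}"
    by (auto simp: in_keys_iff nth_default_def simp del: keys_nth split: if_splits)
  moreover have "map (look (Poly_Mapping.nth \<nu>)) [0..<length \<nu>] = \<nu>"
    by (rule nth_equalityI) (auto simp: nth_default_def)
  moreover have "filter_mset (\<lambda>e. e \<noteq> 0) (mset \<nu>) = mset \<nu>"
    using assms unfolding filter_mset_eq_conv by (force simp: is_partition_def)
  ultimately show ?thesis by (simp add: exps_list)
qed

lemma sum_mset_exps: "sum_mset (exps m) = mdeg m"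
  by (simp add: exps_def mdeg_def sum_unfold_sum_mset)

text \<open>Once both monomials are written as exponent lists of the same length, the numbers of zeros
  agree as well, so the lists are rearrangements of each other.\<close>

lemma exps_eq_imp_permuted:
  assumes "exps m = exps m'"
  obtains n \<sigma> where "\<sigma> permutes {0..<n}" "m = act \<sigma> m'"
proof -
  obtain n0 where n0: "Poly_Mapping.keys m \<subseteq> {..<n0}"
    by (rule monomial_in_finitely_many_variables[of 0])
  obtain n where n: "n \<ge> n0" "Poly_Mapping.keys m' \<subseteq> {..<n}"
    by (rule monomial_in_finitely_many_variables)
  have km: "Poly_Mapping.keys m \<subseteq> {..<n}" using n0 n by force
  let ?xs = "map (look m) [0..<n]" and ?ys = "map (look m') [0..<n]"
  have nz: "filter_mset (\<lambda>e. e \<noteq> 0) (mset ?xs) = filter_mset (\<lambda>e. e \<noteq> 0) (mset ?ys)"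
    using assms exps_list[OF km] exps_list[OF n(2)] by simp
  have split: "M = filter_mset (\<lambda>e. e \<noteq> 0) M + replicate_mset (size M - size (filter_mset (\<lambda>e. e \<noteq> 0) M)) 0"
    for M :: "nat multiset"
  proof -
    have 1: "M = filter_mset (\<lambda>e. e \<noteq> 0) M + filter_mset (\<lambda>e. e = 0) M"
      using multiset_partition[of M "\<lambda>e. e \<noteq> 0"] by simp
    have "filter_mset (\<lambda>e. e = 0) M = replicate_mset (count M 0) 0"
      by (metis filter_eq_replicate_mset)
    moreover have "size M = size (filter_mset (\<lambda>e. e \<noteq> 0) M) + size (filter_mset (\<lambda>e. e = 0) M)"
      by (metis 1 size_union)
    ultimately show ?thesis using 1 by simp
  qed
  have "mset ?xs = mset ?ys"
    using split[of "mset ?xs"] split[of "mset ?ys"] nz by (metis length_map size_mset)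
  then obtain \<sigma> where s: "\<sigma> permutes {..<length ?ys}" "permute_list \<sigma> ?ys = ?xs"
    by (rule mset_eq_permutation)
  have s': "\<sigma> permutes {0..<n}" using s(1) by (simp add: lessThan_atLeast0)
  have "m = act \<sigma> m'"
  proof (rule poly_mapping_eqI)
    fix i
    have b: "bij \<sigma>" using s' by (rule permutes_bij)
    show "look m i = look (act \<sigma> m') i"
    proof (cases "i < n")
      case True
      then have "\<sigma> i < n" using permutes_in_image[OF s', of i] by simp
      moreover have "?xs ! i = ?ys ! \<sigma> i"
        using permute_list_nth[OF s(1), of i] s(2) True by simp
      ultimately show ?thesis using True b by simp
    next
      case False
      then have "\<sigma> i = i" using permutes_not_in[OF s'] by simp
      moreover have "look m i = 0" "look m' i = 0" using km n(2) False by (auto simp: in_keys_iff subset_iff)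
      ultimately show ?thesis using b by simp
    qed
  qed
  with s' show thesis by (rule that)
qed

text \<open>A symmetric series is constant on the monomials with given nonzero exponents, so it is the sum
  over all partitions \<open>\<nu>\<close> of its coefficient at \<open>x\<^sup>\<nu>\<close> times \<open>m\<^sub>\<nu>\<close>. The bound on the degree leaves
  finitely many \<open>\<nu>\<close>.\<close>

lemma spanned_symmetric:
  assumes bd: "bounded_series d f" and sym: "symmetric_from 0 f"
  shows "spanned f"
proof -
  define parts where "parts m = rev (sorted_list_of_multiset (exps m))" for m
  define P where "P = {\<nu>. is_partition \<nu> \<and> sum_list \<nu> < d}"
  have part: "is_partition (parts m)" for m
    by (auto simp: is_partition_def parts_def sorted_wrt_rev exps_def in_keys_iff)
  have mset_parts: "mset (parts m) = exps m" for m by (simp add: parts_def)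
  have unique: "\<nu> = parts m" if "is_partition \<nu>" "mset \<nu> = exps m" for \<nu> m
  proof -
    have "sorted (rev \<nu>)" using that(1) by (simp add: is_partition_def sorted_wrt_rev)
    then have "sorted_list_of_multiset (mset (rev \<nu>)) = rev \<nu>"
      by (metis sorted_list_of_multiset_mset sorted_sort_id)
    then show ?thesis using that(2) by (simp add: parts_def)
  qed
  have msym: "msym \<nu> m = (if \<nu> = parts m then 1 else 0)" if "is_partition \<nu>" for \<nu> m
  proof -
    have "mset \<nu> = exps m \<longleftrightarrow> \<nu> = parts m" using unique[OF that] mset_parts by blast
    then show ?thesis by (simp add: msym_def exps_def eq_commute[of _ "mset \<nu>"])
  qed
  have finP: "finite P"
  proof (rule finite_subset)
    show "P \<subseteq> {xs. set xs \<subseteq> {..<d} \<and> length xs \<le> d}"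
    proof
      fix \<nu> assume "\<nu> \<in> P"
      then have p: "is_partition \<nu>" "sum_list \<nu> < d" by (auto simp: P_def)
      have "length \<nu> \<le> sum_list \<nu>"
        using p(1) sum_list_mono[of \<nu> "\<lambda>_. 1" "\<lambda>x. x"] by (auto simp: is_partition_def sum_list_triv)
      then show "\<nu> \<in> {xs. set xs \<subseteq> {..<d} \<and> length xs \<le> d}"
        using p(2) member_le_sum_list[of _ \<nu>] by force
    qed
  qed (rule finite_lists_length_le, simp)
  have "f m = (\<Sum>\<nu>\<in>P. f (Poly_Mapping.nth \<nu>) * mon_times 0 (msym \<nu>) m)" for m
  proof -
    have "(\<Sum>\<nu>\<in>P. f (Poly_Mapping.nth \<nu>) * mon_times 0 (msym \<nu>) m)
        = (\<Sum>\<nu>\<in>P. if \<nu> = parts m then f (Poly_Mapping.nth (parts m)) else 0)"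
      by (rule sum.cong) (auto simp: P_def msym)
    also have "\<dots> = (if parts m \<in> P then f (Poly_Mapping.nth (parts m)) else 0)"
      using finP by simp
    also have "f (Poly_Mapping.nth (parts m)) = f m"
    proof -
      have "exps (Poly_Mapping.nth (parts m)) = exps m"
        using exps_nth[OF part] mset_parts by simp
      then obtain n \<sigma> where "\<sigma> permutes {0..<n}" "Poly_Mapping.nth (parts m) = act \<sigma> m"
        by (rule exps_eq_imp_permuted)
      then show ?thesis using sym by (simp add: symmetric_from_def)
    qed
    also have "(if parts m \<in> P then f m else 0) = f m"
    proof (cases "f m = 0")
      case False
      then have "mdeg m < d" using bd by (simp add: bounded_series_def)
      moreover have "sum_list (parts m) = mdeg m"
        by (metis mset_parts sum_mset_exps sum_mset_sum_list)
      ultimately show ?thesis using part by (simp add: P_def)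
    qed simp
    finally show ?thesis by simp
  qed
  then have "f = (\<lambda>m. \<Sum>\<nu>\<in>P. f (Poly_Mapping.nth \<nu>) * mon_times 0 (msym \<nu>) m)" by (rule ext)
  moreover have "spanned (\<lambda>m. \<Sum>\<nu>\<in>P. f (Poly_Mapping.nth \<nu>) * mon_times 0 (msym \<nu>) m)"
    by (intro spanned_sum finP spanned_term) (simp add: P_def)
  ultimately show ?thesis by (rule ssubst[of f])
qed

subsection \<open>Spanning: lowering the index of symmetry\<close>

text \<open>Suppose that \<open>\<rho>\<close> moves \<open>k\<close>. The variables with indices \<open>k\<close> and \<open>\<rho> k\<close> are both absent from \<open>m2\<close>, so
  exchanging them does not affect \<open>m2\<close>, and \<open>\<rho>\<close> can be corrected to a permutation fixing \<open>k\<close>.\<close>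

lemma symmetric_from_Suc_permuted:
  assumes sym: "symmetric_from (Suc k) f" and s: "\<rho> permutes {k..<n}"
    and m: "m1 = act \<rho> m2" "look m1 k = 0" "look m2 k = 0"
  shows "f m1 = f m2"
proof (cases "k < n")
  case False
  then have "\<rho> = id" using s by simp
  then show ?thesis using m by simp
next
  case True
  have b: "bij \<rho>" using s by (rule permutes_bij)
  let ?t = "Transposition.transpose k (\<rho> k)"
  have "look m2 (\<rho> k) = 0" using m b by simp
  then have "act ?t m2 = m2"
    using m(3) by (intro poly_mapping_eqI) (auto simp: transpose_def)
  then have "act (?t \<circ> \<rho>) m2 = m1" using m(1) act_act[OF b, of ?t m2] by simp
  moreover have "?t \<circ> \<rho> permutes {Suc k..<n}"
  proof (rule permutes_superset)
    show "?t \<circ> \<rho> permutes {k..<n}"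
      using True permutes_in_image[OF s, of k] by (intro permutes_compose[OF s] permutes_swap_id) auto
    fix x assume "x \<in> {k..<n} - {Suc k..<n}"
    then have "x = k" by auto
    then show "(?t \<circ> \<rho>) x = x" by simp
  qed
  ultimately show ?thesis using sym unfolding symmetric_from_def by metis
qed

text \<open>Setting the variable of index \<open>k\<close> to zero in \<open>f\<close> leaves a series that is symmetric in the later
  variables, and \<open>F\<close> is its extension to a symmetric series in one more variable: the coefficient
  of a monomial is found by renaming the variable of index \<open>k\<close> to a fresh one. Then \<open>f - F\<close> vanishes
  when this variable is zero, so it is divisible by it, with a quotient \<open>h\<close> of smaller degree.\<close>

lemma symmetrize_step:
  assumes bd: "bounded_series (Suc d) f" and sym: "symmetric_from (Suc k) f"
  obtains F h where "bounded_series (Suc d) F" "symmetric_from k F"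
    "bounded_series d h" "symmetric_from (Suc k) h"
    "f = (\<lambda>m. F m + mon_times (Poly_Mapping.single k 1) h m)"
proof -
  define fresh where "fresh m = (SOME n. n > k \<and> look m n = 0)" for m :: mon
  have fresh: "fresh m > k" "look m (fresh m) = 0" for m
  proof -
    obtain n where "n \<ge> Suc k" "Poly_Mapping.keys m \<subseteq> {..<n}"
      by (rule monomial_in_finitely_many_variables)
    then have "n > k \<and> look m n = 0" by (auto simp: in_keys_iff subset_iff)
    then have "fresh m > k \<and> look m (fresh m) = 0" unfolding fresh_def by (rule someI)
    then show "fresh m > k" "look m (fresh m) = 0" by auto
  qed
  \<comment> \<open>Any two admissible results of renaming are related by a permutation of the variables of
    index at least \<open>k\<close>, so the choice of the fresh variable does not affect \<open>F\<close>.\<close>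
  define mv where "mv m = act (Transposition.transpose k (fresh m)) m" for m
  define F where "F m = f (mv m)" for m
  have mv0: "look (mv m) k = 0" for m by (simp add: mv_def fresh)
  have mvmv: "m = act (Transposition.transpose k (fresh m)) (mv m)" for m
    by (rule poly_mapping_eqI) (simp add: mv_def)
  have symF: "symmetric_from k F"
    unfolding symmetric_from_def F_def
  proof (intro allI impI)
    fix n \<sigma> m assume s: "\<sigma> permutes {k..<n}"
    let ?n = "Suc (n + fresh m + fresh (act \<sigma> m))"
    let ?t = "Transposition.transpose k (fresh (act \<sigma> m))" and ?u = "Transposition.transpose k (fresh m)"
    have b: "bij \<sigma>" using s by (rule permutes_bij)
    have "mv (act \<sigma> m) = act ?t (act \<sigma> (act ?u (mv m)))"
      using mvmv[of m] by (simp add: mv_def)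
    also have "\<dots> = act (?u \<circ> (\<sigma> \<circ> ?t)) (mv m)"
      using b by (simp add: act_act bij_comp comp_assoc)
    finally have e: "mv (act \<sigma> m) = act (?u \<circ> (\<sigma> \<circ> ?t)) (mv m)" .
    have "?t permutes {k..<?n}" "?u permutes {k..<?n}"
      using fresh(1)[of m] fresh(1)[of "act \<sigma> m"] by (auto intro!: permutes_swap_id)
    moreover have "\<sigma> permutes {k..<?n}" by (rule permutes_subinterval[OF s]) simp
    ultimately have "?u \<circ> (\<sigma> \<circ> ?t) permutes {k..<?n}"
      by (intro permutes_compose)
    then show "f (mv (act \<sigma> m)) = f (mv m)"
      by (rule symmetric_from_Suc_permuted[OF sym _ e mv0 mv0])
  qed
  have F0: "F m = f m" if "look m k = 0" for m
  proof -
    have "Transposition.transpose k (fresh m) permutes {k..<Suc (fresh m)}"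
      using fresh(1)[of m] by (intro permutes_swap_id) auto
    then show ?thesis
      unfolding F_def
      by (rule symmetric_from_Suc_permuted[OF sym _ _ mv0 that]) (simp add: mv_def)
  qed
  have bdF: "bounded_series (Suc d) F"
    using bd by (auto simp: bounded_series_def F_def mv_def mdeg_act)
  define h where "h m = f (Poly_Mapping.single k 1 + m) - F (Poly_Mapping.single k 1 + m)" for m
  have bdh: "bounded_series d h"
    unfolding bounded_series_def
  proof (intro allI impI)
    fix m assume "h m \<noteq> 0"
    then have "f (Poly_Mapping.single k 1 + m) \<noteq> 0 \<or> F (Poly_Mapping.single k 1 + m) \<noteq> 0"
      by (auto simp: h_def)
    then show "mdeg m < d" using bd bdF by (force simp: bounded_series_def mdeg_add)
  qed
  have symh: "symmetric_from (Suc k) h"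
    unfolding symmetric_from_def
  proof (intro allI impI)
    fix n \<sigma> m assume s: "\<sigma> permutes {Suc k..<n}"
    have b: "bij \<sigma>" using s by (rule permutes_bij)
    have sk: "\<sigma> k = k" using permutes_not_in[OF s] by simp
    have "k = \<sigma> i \<longleftrightarrow> k = i" for i using inj_eq[OF bij_is_inj[OF b], of k i] sk by simp
    then have "act \<sigma> (Poly_Mapping.single k 1) = Poly_Mapping.single k (1::nat)"
      using b by (intro poly_mapping_eqI) (simp add: lookup_single)
    then have e: "Poly_Mapping.single k 1 + act \<sigma> m = act \<sigma> (Poly_Mapping.single k 1 + m)"
      using b by (simp add: act_add)
    have "\<sigma> permutes {k..<n}" using s by (rule permutes_subset) auto
    then show "h (act \<sigma> m) = h m"
      unfolding h_def e using sym symF s unfolding symmetric_from_def by metis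
  qed
  have "f m = F m + mon_times (Poly_Mapping.single k 1) h m" for m
  proof (cases m "Poly_Mapping.single k (1::nat)" rule: mon_times_cases)
    case (div m')
    then show ?thesis by (simp add: h_def)
  next
    case not_div
    have "look m k = 0"
    proof (rule ccontr)
      assume nz: "look m k \<noteq> 0"
      have "m = Poly_Mapping.single k 1 + (m - Poly_Mapping.single k 1)"
        by (rule poly_mapping_eqI) (use nz in \<open>auto simp: lookup_add lookup_minus lookup_single when_def\<close>)
      then show False using not_div(2) by blast
    qed
    then show ?thesis using F0 not_div(1) by simp
  qed
  then show thesis using that bdF symF bdh symh by blast
qed

text \<open>By \<open>symmetrize_step\<close>, either the number \<open>k\<close> of unsymmetric variables or, for fixed \<open>k\<close>, the degree
  bound can be lowered, at the cost of multiplying by a variable.\<close>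

lemma spanned_almost_symmetric:
  "bounded_series d f \<Longrightarrow> symmetric_from k f \<Longrightarrow> spanned f"
proof (induction k arbitrary: d f)
  case 0
  then show ?case by (rule spanned_symmetric)
next
  case (Suc k)
  note IH = Suc.IH
  from Suc.prems show ?case
  proof (induction d arbitrary: f)
    case 0
    then have "f = (\<lambda>_. 0)" by (auto simp: bounded_series_def)
    then show ?case using spanned_zero by simp
  next
    case (Suc d)
    obtain F h where F: "bounded_series (Suc d) F" "symmetric_from k F"
      and h: "bounded_series d h" "symmetric_from (Suc k) h"
      and f: "f = (\<lambda>m. F m + mon_times (Poly_Mapping.single k 1) h m)"
      using symmetrize_step[OF Suc.prems] by blast
    show ?case
      unfolding f by (intro spanned_add spanned_mon_times IH[OF F] Suc.IH[OF h])
  qed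
qed

subsection \<open>Limits\<close>

lemma bounded_mon_times_msym:
  "bounded_series (Suc (sum_list \<alpha> + sum_list \<nu>)) (\<lambda>m. c * mon_times (Poly_Mapping.nth \<alpha>) (msym \<nu>) m)"
  unfolding bounded_series_def
proof (intro allI impI)
  fix m assume nz: "c * mon_times (Poly_Mapping.nth \<alpha>) (msym \<nu>) m \<noteq> 0"
  then have "mon_times (Poly_Mapping.nth \<alpha>) (msym \<nu>) m \<noteq> 0" by (metis mult_zero_right)
  then obtain m' where m': "m = Poly_Mapping.nth \<alpha> + m'"
    using mon_times_not_divisible by blast
  then have "exps m' = mset \<nu>" using nz by (auto simp: msym_def exps_def split: if_splits)
  then have "mdeg m' = sum_list \<nu>" by (metis sum_mset_exps sum_mset_sum_list)
  then show "mdeg m < Suc (sum_list \<alpha> + sum_list \<nu>)" by (simp add: m' mdeg_add mdeg_nth)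
qed

lemma trunc_mon_times_msym:
  assumes "length \<alpha> \<le> n"
  shows "trunc n (\<lambda>m. c * mon_times (Poly_Mapping.nth \<alpha>) (msym \<nu>) m)
    = Const c * xpow \<alpha> * trunc n (msym \<nu>)"
proof (rule poly_mapping_eqI)
  fix m
  have b: "bounded_series (Suc (sum_list \<nu>)) (msym \<nu>)"
    using bounded_mon_times_msym[of "[]" \<nu> 1] by simp
  have k: "Poly_Mapping.keys (Poly_Mapping.nth \<alpha>) \<subseteq> {..<n}"
    using assms by (auto simp: in_keys_iff nth_default_def simp del: keys_nth split: if_splits)
  have "look (Const c * xpow \<alpha> * trunc n (msym \<nu>)) m
      = c * mon_times (Poly_Mapping.nth \<alpha>) (look (trunc n (msym \<nu>))) m"
    by (simp add: xpow_eq_single Const_mult_single look_single_times)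
  also have "\<dots> = (c * mon_times (Poly_Mapping.nth \<alpha>) (msym \<nu>) m when Poly_Mapping.keys m \<subseteq> {..<n})"
  proof (cases m "Poly_Mapping.nth \<alpha>" rule: mon_times_cases)
    case (div m')
    then have "Poly_Mapping.keys m \<subseteq> {..<n} \<longleftrightarrow> Poly_Mapping.keys m' \<subseteq> {..<n}"
      using k by (simp add: keys_add_mon del: keys_nth)
    then show ?thesis using div by (simp add: look_trunc[OF b] mult_when del: keys_nth)
  qed simp
  finally show "look (trunc n (\<lambda>m. c * mon_times (Poly_Mapping.nth \<alpha>) (msym \<nu>) m)) m
      = look (Const c * xpow \<alpha> * trunc n (msym \<nu>)) m"
    by (simp add: look_trunc[OF bounded_mon_times_msym])
qed

lemma as_tendsto_truncations:
  assumes bd: "bounded_series d f" and sym: "symmetric_from k f"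
    and F: "\<And>n. n \<ge> n0 \<Longrightarrow> F n = trunc n f"
  shows "as_tendsto F f"
proof -
  from spanned_almost_symmetric[OF bd sym] obtain ts
    where ts: "\<forall>(\<alpha>, \<nu>, c)\<in>set ts. (\<alpha>, \<nu>) \<in> Sig"
      and f: "f = (\<lambda>m. \<Sum>(\<alpha>, \<nu>, c)\<leftarrow>ts. c * mon_times (Poly_Mapping.nth \<alpha>) (msym \<nu>) m)"
    unfolding spanned_def by blast
  define \<alpha> where "\<alpha> i = fst (ts ! i)" for i
  define \<nu> where "\<nu> i = fst (snd (ts ! i))" for i
  define l where "l i = snd (snd (ts ! i))" for i
  have f': "f = (\<lambda>m. \<Sum>i<length ts. l i * mon_times (Poly_Mapping.nth (\<alpha> i)) (msym (\<nu> i)) m)"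
    unfolding f sum_list_sum_nth
    by (simp add: \<alpha>_def \<nu>_def l_def case_prod_unfold lessThan_atLeast0)
  have Sg: "(\<alpha> i, \<nu> i) \<in> Sig" if "i < length ts" for i
    using ts nth_mem[OF that] by (auto simp: \<alpha>_def \<nu>_def case_prod_unfold)
  have Fn: "F n = (\<Sum>i<length ts. Const (l i) * xpow (\<alpha> i) * trunc n (msym (\<nu> i)))"
    if n: "n \<ge> n0 + (\<Sum>i<length ts. length (\<alpha> i))" for n
  proof -
    let ?T = "\<lambda>i m. l i * mon_times (Poly_Mapping.nth (\<alpha> i)) (msym (\<nu> i)) m"
    have "trunc n f = (\<Sum>i<length ts. trunc n (?T i))"
    proof (rule poly_mapping_eqI)
      fix m
      show "look (trunc n f) m = look (\<Sum>i<length ts. trunc n (?T i)) m"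
        unfolding look_trunc[OF bd] lookup_sum look_trunc[OF bounded_mon_times_msym]
        by (auto simp: f' when_def)
    qed
    also have "\<dots> = (\<Sum>i<length ts. Const (l i) * xpow (\<alpha> i) * trunc n (msym (\<nu> i)))"
    proof (rule sum.cong)
      fix i assume "i \<in> {..<length ts}"
      then have "length (\<alpha> i) \<le> (\<Sum>i<length ts. length (\<alpha> i))"
        by (intro member_le_sum) auto
      then show "trunc n (?T i) = Const (l i) * xpow (\<alpha> i) * trunc n (msym (\<nu> i))"
        using n by (intro trunc_mon_times_msym) simp
    qed simp
    finally show ?thesis using F[of n] n by simp
  qed
  have tad: "t_adic_tendsto (\<lambda>_. l i) (l i)" for i
    unfolding t_adic_tendsto_def
    by (intro allI exI[of _ 0] impI exI[of _ 1]) (simp add: Zero_fract_def[symmetric])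
  show ?thesis
    unfolding as_tendsto_def
    by (rule exI[of _ "length ts"], rule exI[of _ \<alpha>], rule exI[of _ \<nu>],
        rule exI[of _ "\<lambda>i _. l i"], rule exI[of _ l])
      (intro conjI allI impI exI[of _ "n0 + (\<Sum>i<length ts. length (\<alpha> i))"] Sg Fn tad f')
qed

section \<open>Almost symmetric Schur functions\<close>

lemma mdeg_key_poly:
  assumes "look (key_poly \<alpha>) m \<noteq> 0"
  shows "mdeg m = sum_list \<alpha>"
proof -
  have "look (hcomp (sum_list \<alpha>) (key_poly \<alpha>)) m \<noteq> 0"
    using assms by (simp only: hcomp_key_poly not_False_eq_True)
  then show ?thesis by simp
qed

lemma as_schur_base:
  "bounded_series (Suc (sum_list \<mu>)) (look (key_poly \<mu>))"
  "symmetric_from (length \<mu>) (look (key_poly \<mu>))"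
proof -
  show "bounded_series (Suc (sum_list \<mu>)) (look (key_poly \<mu>))"
    by (simp add: bounded_series_def mdeg_key_poly)
  show "symmetric_from (length \<mu>) (look (key_poly \<mu>))"
    unfolding symmetric_from_def
  proof (intro allI impI)
    fix n \<sigma> m assume s: "\<sigma> permutes {length \<mu>..<n}"
    let ?K = "key_poly \<mu>"
    have b: "bij \<sigma>" using s by (rule permutes_bij)
    have zero: "look ?K m = 0" if "look m i \<noteq> 0" "i \<ge> length \<mu>" for m i
    proof -
      have "\<not> Poly_Mapping.keys m \<subseteq> {..<length \<mu>}" using that by (auto simp: in_keys_iff subset_iff)
      then show ?thesis
        using arg_cong[OF tr_key_poly[of \<mu> "length \<mu>"], of "\<lambda>p. look p m"] by simp
    qed
    have small: "\<sigma> i = i" if "i < length \<mu>" for i using permutes_not_in[OF s] that by simp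
    show "look ?K (act \<sigma> m) = look ?K m"
    proof (cases "\<exists>i\<ge>length \<mu>. look m i \<noteq> 0")
      case True
      then obtain i where i: "i \<ge> length \<mu>" "look m i \<noteq> 0" by blast
      obtain j where j: "\<sigma> j = i" using b by (metis bij_pointE)
      then have "j \<ge> length \<mu>" using small[of j] i by (metis not_le)
      then show ?thesis using zero[of m i] zero[of "act \<sigma> m" j] i j b by simp
    next
      case False
      have "\<sigma> i \<ge> length \<mu>" if "i \<ge> length \<mu>" for i
        using that permutes_in_image[OF s, of i] permutes_not_in[OF s, of i] by (cases "i < n") auto
      then have "act \<sigma> m = m"
        using False small b by (intro poly_mapping_eqI) (metis look_act not_le)
      then show ?thesis by simp
    qed
  qed
qed

lemma W_rel_unique: "W_rel k n f g \<Longrightarrow> W_rel k n f g' \<Longrightarrow> g = g'"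
  unfolding W_rel_def by (metis Delta_neq_0 mult_left_cancel)

text \<open>The polynomials \<open>G N\<close> are the images of the truncations of \<open>f\<close> under the finite symmetrisers, hence
  they are truncations of each other, and together they define a series \<open>g\<close>. It is almost
  symmetric, because all \<open>G N\<close> have the same degree and are symmetric after \<open>\<mu>\<close>. So \<open>g\<close> has the
  property that describes \<open>W f\<close>, and it is the only such series, being determined by its
  truncations.\<close>

lemma as_schur_step:
  assumes bd: "bounded_series d f"
    and f: "\<And>N. N \<ge> length \<mu> + 1 + length \<nu> \<Longrightarrow>
      trunc N f = key_poly ((\<mu> @ [a]) @ replicate (N - (length \<mu> + 1 + length \<nu>)) 0 @ rev \<nu>)"
    and srt: "sorted (rev \<nu> @ [a])"
  defines "G \<equiv> \<lambda>N. key_poly (\<mu> @ replicate (N - (length \<mu> + 1 + length \<nu>)) 0 @ rev \<nu> @ [a])"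
  shows "\<exists>d'. bounded_series d' (W (length \<mu>) f) \<and> symmetric_from (length \<mu>) (W (length \<mu>) f) \<and>
    (\<forall>N\<ge>length \<mu> + 1 + length \<nu>. trunc N (W (length \<mu>) f) = G N)"
proof -
  define k where "k = length \<mu>"
  define N0 where "N0 = k + 1 + length \<nu>"
  have f': "trunc N f = key_poly (\<mu> @ a # replicate (N - N0) 0 @ rev \<nu>)" if "N \<ge> N0" for N
    using f[of N] that by (simp add: N0_def k_def)
  have G: "G N = key_poly (\<mu> @ (replicate (N - N0) 0 @ rev \<nu>) @ [a])" for N
    by (simp add: G_def N0_def k_def)
  have srt': "sorted ((replicate j 0 @ rev \<nu>) @ [a])" for j
    using srt by (auto simp: sorted_append)
  have rel: "W_rel k N (trunc N f) (G N)" if "N \<ge> N0" for N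
    using W_rel_key_poly[OF srt'[of "N - N0"], of \<mu>] that
    by (simp add: f' G k_def N0_def)
  have trG: "tr N (G N) = G N" if "N \<ge> N0" for N
    unfolding G using that by (intro tr_key_poly) (simp add: N0_def k_def)
  have trf: "tr n (trunc N f) = trunc n f" if "n \<le> N" for n N
    using that by (intro poly_mapping_eqI) (auto simp: look_trunc[OF bd] when_def)
  \<comment> \<open>The description of \<open>W\<close> involves all \<open>n \<ge> k\<close>; those below \<open>N0\<close>, where no \<open>G n\<close> is available, are reached
    by truncation from above.\<close>
  have rel': "W_rel k n (trunc n f) (tr n (G N))" if "k \<le> n" "n \<le> N" "N \<ge> N0" for n N
    using W_rel_tr_le[OF that(1,2) rel[OF that(3)]] trf that trG by simp
  have trGG: "tr n (G N) = G n" if "N0 \<le> n" "n \<le> N" for n N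
    using W_rel_unique[OF rel'[of n N] rel[of n]] that by (simp add: N0_def)
  \<comment> \<open>By \<open>trGG\<close>, any number of variables that is at least \<open>N0\<close> and includes those of \<open>m\<close> gives the
    same coefficient.\<close>
  define g where "g m = look (G (N0 + Poly_Mapping.degree m)) m" for m
  have keys_deg: "Poly_Mapping.keys m \<subseteq> {..<N0 + Poly_Mapping.degree m}" for m :: mon
    by (auto dest!: in_keys_less_degree)
  have g: "g m = look (G N) m" if "N \<ge> N0" "Poly_Mapping.keys m \<subseteq> {..<N}" for N m
  proof -
    have mono: "look (G n) m = look (G n') m"
      if "N0 \<le> n" "n \<le> n'" "Poly_Mapping.keys m \<subseteq> {..<n}" for n n'
      using trGG[OF that(1,2)] that(3) by (metis look_tr "when"(1))
    show ?thesis
      unfolding g_def using mono that keys_deg[of m] by (metis le_add1 nat_le_linear)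
  qed
  have bdg: "bounded_series (Suc (sum_list \<mu> + sum_list \<nu> + a)) g"
    unfolding bounded_series_def
  proof (intro allI impI)
    fix m assume "g m \<noteq> 0"
    then have "look (G (N0 + Poly_Mapping.degree m)) m \<noteq> 0" by (simp add: g_def)
    then have "mdeg m = sum_list (\<mu> @ (replicate (N0 + Poly_Mapping.degree m - N0) 0 @ rev \<nu>) @ [a])"
      unfolding G by (rule mdeg_key_poly)
    then show "mdeg m < Suc (sum_list \<mu> + sum_list \<nu> + a)" by (simp add: sum_list_rev)
  qed
  have symg: "symmetric_from k g"
    unfolding symmetric_from_def
  proof (intro allI impI)
    fix n \<sigma> m assume s: "\<sigma> permutes {k..<n}"
    have b: "bij \<sigma>" using s by (rule permutes_bij)
    define N where "N = n + N0 + Poly_Mapping.degree m + Poly_Mapping.degree (act \<sigma> m)"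
    have "g m = look (G N) m" "g (act \<sigma> m) = look (G N) (act \<sigma> m)"
      by (intro g; auto simp: N_def dest!: in_keys_less_degree)+
    moreover have "perm_pol \<sigma> (G N) = G N"
    proof (rule perm_pol_invariantI)
      show "\<sigma> permutes {k..<N}" by (rule permutes_subinterval[OF s]) (simp add: N_def)
      fix i assume "k \<le> i" "Suc i < N"
      then show "ps i (G N) = G N"
        unfolding G using srt' by (intro ps_key_poly_sorted_tail) (auto simp: k_def N0_def N_def)
    qed
    ultimately show "g (act \<sigma> m) = g m" using b by (metis look_perm_pol)
  qed
  have trg: "trunc n g = tr n (G N)" if "N0 \<le> N" "n \<le> N" for n N
  proof (rule poly_mapping_eqI)
    fix m :: mon
    have "Poly_Mapping.keys m \<subseteq> {..<n} \<Longrightarrow> Poly_Mapping.keys m \<subseteq> {..<N}" using that by force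
    then show "look (trunc n g) m = look (tr n (G N)) m"
      using g[OF that(1)] by (auto simp: look_trunc[OF bdg] when_def)
  qed
  have Wg: "trunc n g = W_fin k n (trunc n f)" if "n \<ge> k" for n
    using W_fin_eqI[OF that rel'[OF that, of "n + N0"]] trg[of "n + N0" n] by simp
  have "W k f = g"
    unfolding W_def
  proof (rule the_equality)
    show "g \<in> P_as \<and> (\<forall>n\<ge>k. trunc n g = W_fin k n (trunc n f))"
      using P_partI[OF bdg symg] Wg by (auto simp: P_as_def)
    fix g' assume g': "g' \<in> P_as \<and> (\<forall>n\<ge>k. trunc n g' = W_fin k n (trunc n f))"
    then obtain d' where "bounded_series d' g'" using P_as_bounded by blast
    then show "g' = g" by (rule bounded_series_eqI[OF _ bdg, where k = k]) (use g' Wg in simp)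
  qed
  moreover have "trunc N g = G N" if "N \<ge> N0" for N
    using trg[OF that, of N] trG[OF that] by simp
  ultimately show ?thesis using bdg symg unfolding k_def N0_def by auto
qed

lemma as_schur_truncations:
  assumes "is_partition \<nu>"
  shows "\<exists>d. bounded_series d (as_schur \<mu> \<nu>) \<and> symmetric_from (length \<mu>) (as_schur \<mu> \<nu>) \<and>
    (\<forall>N\<ge>length \<mu> + length \<nu>.
       trunc N (as_schur \<mu> \<nu>) = key_poly (\<mu> @ replicate (N - (length \<mu> + length \<nu>)) 0 @ rev \<nu>))"
  using assms
proof (induction \<nu> arbitrary: \<mu>)
  case Nil
  have "trunc N (look (key_poly \<mu>)) = key_poly \<mu>" if "N \<ge> length \<mu>" for N
    using tr_key_poly[OF that] by (simp add: tr_def)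
  then show ?case
    by (intro exI[of _ "Suc (sum_list \<mu>)"]) (simp add: as_schur_base key_poly_append_zeros)
next
  case (Cons a \<nu>)
  then have part: "is_partition \<nu>" and srt: "sorted (rev \<nu> @ [a])"
    by (auto simp: is_partition_def sorted_append sorted_wrt_rev)
  from Cons.IH[OF part, of "\<mu> @ [a]"] obtain d where
    bd: "bounded_series d (as_schur (\<mu> @ [a]) \<nu>)" and
    f: "\<And>N. N \<ge> length \<mu> + 1 + length \<nu> \<Longrightarrow> trunc N (as_schur (\<mu> @ [a]) \<nu>)
      = key_poly ((\<mu> @ [a]) @ replicate (N - (length \<mu> + 1 + length \<nu>)) 0 @ rev \<nu>)"
    by auto
  show ?case using as_schur_step[OF bd f srt] by simp
qed

theorem proposition4p3:
  fixes \<mu> \<nu> :: "nat list"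
  assumes "(\<mu>, \<nu>) \<in> Sig"
  shows "as_tendsto
           (\<lambda>N. key_poly (\<mu> @ replicate (N - (length \<mu> + length \<nu>)) 0 @ rev \<nu>))
           (as_schur \<mu> \<nu>)"
proof -
  from assms have "is_partition \<nu>" by (simp add: Sig_def)
  from as_schur_truncations[OF this, of \<mu>] obtain d where
    "bounded_series d (as_schur \<mu> \<nu>)" "symmetric_from (length \<mu>) (as_schur \<mu> \<nu>)" and
    *: "\<And>N. N \<ge> length \<mu> + length \<nu> \<Longrightarrow>
      trunc N (as_schur \<mu> \<nu>) = key_poly (\<mu> @ replicate (N - (length \<mu> + length \<nu>)) 0 @ rev \<nu>)"
    by blast
  then show ?thesis
    by (intro as_tendsto_truncations[of d _ "length \<mu>" "length \<mu> + length \<nu>"]) (simp_all only: *)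
qed

end
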